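(* Let $$B=\{f:(-1,1)\to\mathbb{C}\mid f,f',f'',f'''\in AC_{\mathrm{loc}}(-1,1);\ (1-x^2)^2f^{(4)}\in L^2(-1,1)\}$$ and let $\mathcal{D}(S)$ be the set of all $f:(-1,1)\to\mathbb{C}$ such that $f,f',f'',f'''\in AC_{\mathrm{loc}}(-1,1)$, $f,\ell^2[f]\in L^2(-1,1)$, $\lim_{x\to\pm1}[f,1]_2(x)=0$ and $\lim_{x\to\pm1}[f,x]_2(x)=0$. Then $$B=\mathcal{D}(S).$$
   Context: $AC_{\mathrm{loc}}(-1,1)$ denotes the complex-valued functions on $(-1,1)$ that are absolutely continuous on every compact subinterval. The square of the Legendre expression is $$\ell^2[y](x)=\left((1-x^2)^2y''(x)\right)''-2\left((1-x^2)y'(x)\right)' ,$$ defined for a.e. $x\in(-1,1)$. The associated sesquilinear form is $$[f,g]_2(x)=\left((1-x^2)^2f''\right)'\overline{g}-\left((1-x^2)^2\overline{g}''\right)'f-(1-x^2)^2f''\overline{g}'+(1-x^2)^2f'\overline{g}''-2(1-x^2)f'\overline{g}+2(1-x^2)f\overline{g}',$$ all functions evaluated at $x\in(-1,1)$. In $[f,1]_2$ and $[f,x]_2$ the second argument is the constant function $1$, respectively the identity function $x\mapsto x$; thus $[f,1]_2(x)=\left((1-x^2)^2f''(x)\right)'-2(1-x^2)f'(x)$ and $[f,x]_2(x)=x[f,1]_2(x)-(1-x^2)^2f''(x)+2(1-x^2)f(x)$. A limit "$x\to\pm1$" means both one-sided limits, $x\to1^-$ and $x\to-1^+$. *)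

theory Defs
  imports "HOL-Analysis.Analysis"
begin

text \<open>Functions on \<open>(-1,1)\<close> are represented by total functions on the reals. Membership in the
  sets defined below depends only on the values in the open interval.\<close>

definition II :: "real set" where
  "II = {-1<..<1}"

text \<open>Absolute continuity on \<open>[a,b]\<close>. A set \<open>d\<close> with \<open>d division_of \<Union>d\<close> is an arbitrary finite family
  of nonoverlapping compact intervals; it need not cover \<open>[a,b]\<close>.\<close>

definition abs_cont_on :: "real \<Rightarrow> real \<Rightarrow> (real \<Rightarrow> complex) \<Rightarrow> bool" where
  "abs_cont_on a b f \<longleftrightarrow>
     (\<forall>\<epsilon>>0. \<exists>\<delta>>0. \<forall>d. d division_of \<Union>d \<and> \<Union>d \<subseteq> {a..b} \<and> (\<Sum>k\<in>d. Sup k - Inf k) < \<delta>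
        \<longrightarrow> (\<Sum>k\<in>d. norm (f (Sup k) - f (Inf k))) < \<epsilon>)"

definition AC_loc :: "(real \<Rightarrow> complex) set" where
  "AC_loc = {f. \<forall>a b. -1 < a \<and> a \<le> b \<and> b < 1 \<longrightarrow> abs_cont_on a b f}"

text \<open>The value at points of nondifferentiability is arbitrary. Below it is only used where the
  derivative exists, or exists almost everywhere and the result is considered up to null sets.\<close>

definition D :: "(real \<Rightarrow> complex) \<Rightarrow> real \<Rightarrow> complex" where
  "D f = (\<lambda>x. vector_derivative f (at x))"

text \<open>\<open>f, f', f'', f''' \<in> AC_loc\<close>, which presupposes that these derivatives exist everywhere on
  the interval.\<close>

definition AC3_loc :: "(real \<Rightarrow> complex) set" where
  "AC3_loc = {f. (\<forall>k<3. \<forall>x\<in>II. (D ^^ k) f differentiable (at x)) \<and> (\<forall>k\<le>3. (D ^^ k) f \<in> AC_loc)}"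

text \<open>Measurability and integrability refer to the completed Lebesgue measure, hence are insensitive
  to changes on null sets.\<close>

definition L2 :: "(real \<Rightarrow> complex) set" where
  "L2 = {g. g \<in> borel_measurable (lebesgue_on II) \<and> integrable (lebesgue_on II) (\<lambda>x. (norm (g x))\<^sup>2)}"

definition legendre_sq :: "(real \<Rightarrow> complex) \<Rightarrow> real \<Rightarrow> complex" where
  "legendre_sq y = (\<lambda>x. D (D (\<lambda>t. (1 - t\<^sup>2)\<^sup>2 *\<^sub>R D (D y) t)) x
                        - 2 * D (\<lambda>t. (1 - t\<^sup>2) *\<^sub>R D y t) x)"

definition sesq_form :: "(real \<Rightarrow> complex) \<Rightarrow> (real \<Rightarrow> complex) \<Rightarrow> real \<Rightarrow> complex" where
  "sesq_form f g x =
     (let gc = (\<lambda>t. cnj (g t)) in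
        D (\<lambda>t. (1 - t\<^sup>2)\<^sup>2 *\<^sub>R D (D f) t) x * gc x
      - D (\<lambda>t. (1 - t\<^sup>2)\<^sup>2 *\<^sub>R D (D gc) t) x * f x
      - (1 - x\<^sup>2)\<^sup>2 *\<^sub>R (D (D f) x * D gc x)
      + (1 - x\<^sup>2)\<^sup>2 *\<^sub>R (D f x * D (D gc) x)
      - (2 * (1 - x\<^sup>2)) *\<^sub>R (D f x * gc x)
      + (2 * (1 - x\<^sup>2)) *\<^sub>R (f x * D gc x))"

definition B :: "(real \<Rightarrow> complex) set" where
  "B = {f \<in> AC3_loc. (\<lambda>x. (1 - x\<^sup>2)\<^sup>2 *\<^sub>R (D ^^ 4) f x) \<in> L2}"

definition dom_S :: "(real \<Rightarrow> complex) set" where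
  "dom_S = {f \<in> AC3_loc. f \<in> L2 \<and> legendre_sq f \<in> L2 \<and>
     (sesq_form f (\<lambda>_. 1) \<longlongrightarrow> 0) (at_left 1) \<and>
     (sesq_form f (\<lambda>_. 1) \<longlongrightarrow> 0) (at_right (-1)) \<and>
     (sesq_form f complex_of_real \<longlongrightarrow> 0) (at_left 1) \<and>
     (sesq_form f complex_of_real \<longlongrightarrow> 0) (at_right (-1))}"

lemma D_eqI: "(\<And>x. (f has_vector_derivative f' x) (at x)) \<Longrightarrow> D f = f'"
  by (auto simp: D_def fun_eq_iff intro!: vector_derivative_at)

lemma D_const [simp]: "D (\<lambda>_. c) = (\<lambda>_. 0)"
  by (rule D_eqI) auto

lemma D_of_real [simp]: "D complex_of_real = (\<lambda>_. 1)"
  by (rule D_eqI) (use has_vector_derivative_of_real[OF DERIV_ident] in auto)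

lemma sesq_form_one:
  "sesq_form f (\<lambda>_. 1) x =
     D (\<lambda>t. (1 - t\<^sup>2)\<^sup>2 *\<^sub>R D (D f) t) x - (2 * (1 - x\<^sup>2)) *\<^sub>R D f x"
  by (simp add: sesq_form_def)

lemma sesq_form_ident:
  "sesq_form f complex_of_real x =
     x *\<^sub>R sesq_form f (\<lambda>_. 1) x - (1 - x\<^sup>2)\<^sup>2 *\<^sub>R D (D f) x + (2 * (1 - x\<^sup>2)) *\<^sub>R f x"
  by (simp add: sesq_form_def scaleR_conv_of_real algebra_simps)

end

theory Submission
  imports Defs
begin

text \<open>Write \<open>p = 1 - x\<^sup>2\<close>. If \<open>p\<^sup>2 f'''' \<in> L\<^sup>2\<close>, then \<open>f''' = O(p powr (-3/2))\<close>, \<open>f'' = O(p powr (-1/2))\<close>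
  and \<open>f'\<close>, \<open>f\<close> are bounded, so the boundary terms vanish, and a weighted Hardy inequality puts \<open>p f'''\<close>
  and \<open>f''\<close> into \<open>L\<^sup>2\<close>. Conversely, let \<open>q = (p f')'\<close>. Then \<open>[f,1] = p q'\<close> has derivative \<open>\<ell>\<^sup>2[f]\<close> and
  vanishes at both end points, so Hardy's inequality gives \<open>q' \<in> L\<^sup>2\<close>; the vanishing of \<open>[f,x]\<close> then
  forces \<open>p f' \<longlongrightarrow> 0\<close>, so \<open>f'\<close> is bounded. Since \<open>(p\<^sup>2 f'')' = p (q' + 2 f')\<close>, Hardy's inequality gives
  \<open>f'' \<in> L\<^sup>2\<close>, and the remaining terms follow.

  The fundamental theorem of calculus for absolutely continuous functions rests on the almost everywhere
  differentiability of functions of bounded variation, proved with Vitali's covering theorem.\<close>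

section \<open>Almost everywhere differentiability of functions of bounded variation\<close>

text \<open>The limits of [f,x] cannot be dropped: for f = ln((1+x)/(1-x)) one has p f' = 2, so
  [f,1] and l^2[f] vanish identically and f lies in L^2, yet f' is unbounded; only [f,x], which
  tends to -4 at 1 and to 4 at -1, excludes it. From [f,1] alone one gets q bounded, and [f,x] then
  removes the remaining limit of p f' at each end.

  A single Hardy inequality with integer exponent m is applied four times: m = 1, 0 for the
  inclusion of B in D(S), and m = -1, -2 for the converse. Only finiteness of an integral matters,
  so p^n |v|^2 with n = 2m+1 need only be bounded. For n > 0 this is a growth bound, found by
  integrating from 0; for n < 0 it is a decay bound, found by integrating from the end points, and
  here the boundary conditions enter. The critical exponent n = 0, where Hardy's inequality fails,
  never occurs since n is odd.

  Integrals of derivatives are gauge integrals, so absolute integrability of the derivative of an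
  absolutely continuous function is never at issue.\<close>

lemma division_interval:
  fixes d :: "real set set"
  assumes "d division_of i" "k \<in> d"
  shows "k = {Inf k..Sup k}" "Inf k \<le> Sup k" "Inf k \<in> i" "Sup k \<in> i" "Inf k \<in> k" "Sup k \<in> k"
proof -
  obtain u v where k: "k = cbox u v" and ne: "k \<noteq> {}" and sub: "k \<subseteq> i"
    using division_ofD(2,3,4)[OF assms(1)] assms(2) by metis
  then have "u \<le> v" by auto
  then show "k = {Inf k..Sup k}" "Inf k \<le> Sup k" "Inf k \<in> i" "Sup k \<in> i" "Inf k \<in> k" "Sup k \<in> k"
    using k sub by auto
qed

lemma division_sum_endpoints:
  fixes F :: "real \<Rightarrow> 'a::real_normed_vector"
  assumes "d division_of {a..b}" "a \<le> b"
  shows "(\<Sum>k\<in>d. F (Sup k) - F (Inf k)) = F b - F a"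
proof -
  \<comment> \<open>Telescoping is available for tagged divisions; tagging each member with its left
    end point supplies one.\<close>
  let ?p = "(\<lambda>k. (Inf k, k)) ` d"
  have "?p tagged_division_of {a..b}"
  proof (rule tagged_division_ofI)
    show "finite ?p" using division_ofD(1)[OF assms(1)] by simp
    show "x \<in> K" if "(x, K) \<in> ?p" for x K
      using that division_interval[OF assms(1)] by (metis (no_types, lifting) atLeastAtMost_iff image_iff order_refl prod.inject)
    show "K \<subseteq> {a..b}" "\<exists>a b. K = cbox a b" if "(x, K) \<in> ?p" for x K
      using that division_ofD(2,4)[OF assms(1)] by auto
    show "interior K1 \<inter> interior K2 = {}"
      if "(x1, K1) \<in> ?p" "(x2, K2) \<in> ?p" "(x1, K1) \<noteq> (x2, K2)" for x1 K1 x2 K2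
      using that division_ofD(5)[OF assms(1)] by auto
    have "{K. \<exists>x. (x, K) \<in> ?p} = d" by auto
    then show "\<Union> {K. \<exists>x. (x, K) \<in> ?p} = {a..b}"
      using division_ofD(6)[OF assms(1)] by simp
  qed
  from additive_tagged_division_1[OF assms(2) this, of F]
  show ?thesis by (subst (asm) sum.reindex) (auto simp: inj_on_def)
qed

text \<open>Completing the family to a division of the whole interval adds only nonnegative
  increments, and then the sum telescopes.\<close>

lemma mono_sum_division_le:
  fixes F :: "real \<Rightarrow> real"
  assumes "mono_on {a..b} F" "d division_of \<Union>d" "\<Union>d \<subseteq> {a..b}" "a \<le> b"
  shows "(\<Sum>k\<in>d. F (Sup k) - F (Inf k)) \<le> F b - F a"
proof -
  obtain q where q: "d \<subseteq> q" "q division_of {a..b}"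
    using partial_division_extend_interval[of d a b] assms(2,3) by auto
  have "(\<Sum>k\<in>d. F (Sup k) - F (Inf k)) \<le> (\<Sum>k\<in>q. F (Sup k) - F (Inf k))"
  proof (rule sum_mono2)
    show "finite q" using q(2) by auto
    fix k assume "k \<in> q - d"
    then show "0 \<le> F (Sup k) - F (Inf k)"
      using division_interval[OF q(2), of k] mono_onD[OF assms(1), of "Inf k" "Sup k"] by auto
  qed fact
  then show ?thesis using division_sum_endpoints[OF q(2) assms(4), of F] by simp
qed

lemma division_length_bound:
  fixes d :: "real set set"
  assumes "d division_of \<Union>d" "\<Union>d \<subseteq> {a..b}" "a \<le> b"
  shows "(\<Sum>k\<in>d. Sup k - Inf k) \<le> b - a"
  using mono_sum_division_le[of a b "\<lambda>x. x" d] assms by (auto simp: mono_on_def)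

lemma division_measure_Union:
  fixes d :: "real set set"
  assumes "d division_of \<Union>d"
  shows "measure lebesgue (\<Union>d) = (\<Sum>k\<in>d. Sup k - Inf k)"
proof -
  have "measure lebesgue (\<Union>d) = (\<Sum>k\<in>d. measure lebesgue k)"
  proof (rule measure_negligible_finite_Union)
    show "finite d" using assms by auto
    show "S \<in> lmeasurable" if "S \<in> d" for S
      using division_ofD(4)[OF assms that] by auto
    show "pairwise (\<lambda>S T. negligible (S \<inter> T)) d"
    proof (rule pairwiseI)
      fix S T assume st: "S \<in> d" "T \<in> d" "S \<noteq> T"
      then have "interior S \<inter> interior T = {}"
        using division_ofD(5)[OF assms] by auto
      \<comment> \<open>Distinct members may share an end point. Their intersection is again an
        interval, and having empty interior it is null.\<close>
      moreover obtain w z where wz: "S \<inter> T = cbox w z"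
      proof -
        obtain a b where S: "S = cbox a b" using division_ofD(4)[OF assms st(1)] by blast
        obtain c e where T: "T = cbox c e" using division_ofD(4)[OF assms st(2)] by blast
        show ?thesis using that Int_interval[of a b c e] unfolding S T by blast
      qed
      ultimately have "box w z = {}"
        using interior_cbox[of w z] interior_Int[of S T] by simp
      then show "negligible (S \<inter> T)"
        unfolding wz by (simp only: negligible_interval)
    qed
  qed
  also have "\<dots> = (\<Sum>k\<in>d. Sup k - Inf k)"
  proof (rule sum.cong[OF refl])
    fix k assume "k \<in> d"
    define u v where "u = Inf k" and "v = Sup k"
    have "k = {u..v}" "u \<le> v"
      using division_interval(1,2)[OF assms \<open>k \<in> d\<close>] unfolding u_def v_def by auto
    then show "measure lebesgue k = Sup k - Inf k" by simp
  qed
  finally show ?thesis .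
qed

section \<open>An outer measure bound from Vitali's theorem\<close>

text \<open>Vitali's theorem selects countably many disjoint members of \<open>K\<close> that
  exhaust \<open>S\<close> up to a null set. Every finite part of the selection is a division, so
  \<open>bound\<close> applies to it, and the estimate passes to the countable union.\<close>

lemma Vitali_interval_cover:
  fixes S :: "real set"
  assumes K: "\<And>k. k \<in> K \<Longrightarrow> \<exists>u v. u < v \<and> k = {u..v}"
    and fine: "\<And>x e. x \<in> S \<Longrightarrow> 0 < e \<Longrightarrow> \<exists>k\<in>K. x \<in> k \<and> Sup k - Inf k < e"
    and bound: "\<And>d. d division_of \<Union>d \<Longrightarrow> d \<subseteq> K \<Longrightarrow> (\<Sum>k\<in>d. Sup k - Inf k) \<le> e"
  obtains T where "S \<subseteq> T" "T \<in> lmeasurable" "measure lebesgue T \<le> e"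
proof -
  \<comment> \<open>The covering theorem speaks of closed balls; on the line these are the
    intervals, described by midpoint and half length.\<close>
  let ?a = "\<lambda>k::real set. (Inf k + Sup k) / 2" and ?r = "\<lambda>k::real set. (Sup k - Inf k) / 2"
  have cb: "cball (?a k) (?r k) = k" "0 < ?r k" if kK: "k \<in> K" for k
  proof -
    obtain u v where "u < v" "k = {u..v}" using K[OF kK] by blast
    then show "cball (?a k) (?r k) = k" "0 < ?r k"
      by (auto simp: cball_eq_atLeastAtMost field_simps)
  qed
  have ex: "\<exists>k. k \<in> K \<and> x \<in> cball (?a k) (?r k) \<and> ?r k < e" if xe: "x \<in> S" "0 < e" for x e
  proof -
    obtain k where k: "k \<in> K" "x \<in> k" "Sup k - Inf k < e" using fine[OF xe] by blast
    then show ?thesis using cb[of k] by (intro exI[of _ k]) auto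
  qed
  obtain C where C: "countable C" "C \<subseteq> K"
     "pairwise (\<lambda>i j. disjnt (cball (?a i) (?r i)) (cball (?a j) (?r j))) C"
     "negligible (S - (\<Union>i \<in> C. cball (?a i) (?r i)))"
  proof (rule Vitali_covering_theorem_cballs[of K ?r S ?a])
    show "0 < ?r i" if "i \<in> K" for i using cb(2) that .
    show "\<exists>i. i \<in> K \<and> x \<in> cball (?a i) (?r i) \<and> ?r i < e" if "x \<in> S" "0 < e" for x e
      using ex[OF that] .
  qed blast
  have CU: "(\<Union>i \<in> C. cball (?a i) (?r i)) = (\<Union>i\<in>C. i)"
    using cb(1) C(2) by auto
  have disj: "i \<inter> j = {}" if "i \<in> C" "j \<in> C" "i \<noteq> j" for i j
    using C(2,3) that cb(1) unfolding pairwise_def disjnt_def by (metis subsetD)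
  have lm: "k \<in> lmeasurable" if "k \<in> C" for k
    using K C(2) that by (metis subsetD lmeasurable_cbox box_real(2))
  have fin: "measure lebesgue (\<Union>i\<in>I. i) \<le> e" if I: "I \<subseteq> C" "finite I" for I
  proof -
    have "I division_of \<Union>I"
    proof (rule division_ofI)
      show "finite I" by fact
      fix k assume "k \<in> I"
      then obtain u v where "u < v" "k = {u..v}" using K C(2) I(1) by (meson subsetD)
      then show "k \<noteq> {}" "\<exists>a b. k = cbox a b" "k \<subseteq> \<Union>I" using \<open>k \<in> I\<close> by auto
      fix k' assume "k' \<in> I" "k \<noteq> k'"
      then show "interior k \<inter> interior k' = {}"
        using disj[of k k'] \<open>k \<in> I\<close> I(1) interior_subset by blast
    qed auto
    with bound[of I] I(1) C(2) show ?thesis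
      by (simp add: division_measure_Union)
  qed
  have T: "(\<Union>i\<in>C. i) \<in> lmeasurable" "measure lebesgue (\<Union>i\<in>C. i) \<le> e"
    using fmeasurable_UN_bound[OF C(1) lm fin] measure_UN_bound[OF C(1) lm fin] by auto
  let ?N = "S - (\<Union>i\<in>C. i)"
  have N: "negligible ?N" using C(4) CU by simp
  show ?thesis
  proof
    show "S \<subseteq> ?N \<union> (\<Union>i\<in>C. i)" by auto
    have "?N \<in> lmeasurable" using N by (simp add: negligible_imp_measurable)
    then show "?N \<union> (\<Union>i\<in>C. i) \<in> lmeasurable" using T(1) by (rule fmeasurable.Un)
    show "measure lebesgue (?N \<union> (\<Union>i\<in>C. i)) \<le> e"
      using measure_Un_le[of ?N lebesgue "\<Union>i\<in>C. i"] T N \<open>?N \<in> lmeasurable\<close>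
      by (simp add: negligible_imp_measure0 fmeasurableD)
  qed
qed

section \<open>Total variation and difference quotients\<close>

text \<open>As in \<open>abs_cont_on\<close>, the families need not cover \<open>{a..b}\<close>, so
  a variation bound carries over from there without completing any family.\<close>

definition bounded_var :: "real \<Rightarrow> real \<Rightarrow> (real \<Rightarrow> real) \<Rightarrow> bool" where
  "bounded_var a b g \<longleftrightarrow> (\<exists>M. \<forall>d. d division_of \<Union>d \<and> \<Union>d \<subseteq> {a..b}
      \<longrightarrow> (\<Sum>k\<in>d. \<bar>g (Sup k) - g (Inf k)\<bar>) \<le> M)"

text \<open>Subtracting a line shifts every difference quotient by its slope. This serves to centre
  a gap between two limit values of the quotients at 0.\<close>

lemma bounded_var_diff_linear:
  assumes "bounded_var a b g" "a \<le> b"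
  shows "bounded_var a b (\<lambda>x. g x - r * x)"
proof -
  obtain M where M: "\<And>d. d division_of \<Union>d \<Longrightarrow> \<Union>d \<subseteq> {a..b} \<Longrightarrow> (\<Sum>k\<in>d. \<bar>g (Sup k) - g (Inf k)\<bar>) \<le> M"
    using assms(1) unfolding bounded_var_def by blast
  have "(\<Sum>k\<in>d. \<bar>(g (Sup k) - r * Sup k) - (g (Inf k) - r * Inf k)\<bar>) \<le> M + \<bar>r\<bar> * (b - a)"
    if d: "d division_of \<Union>d" "\<Union>d \<subseteq> {a..b}" for d
  proof -
    have "(\<Sum>k\<in>d. \<bar>(g (Sup k) - r * Sup k) - (g (Inf k) - r * Inf k)\<bar>)
       \<le> (\<Sum>k\<in>d. \<bar>g (Sup k) - g (Inf k)\<bar> + \<bar>r\<bar> * (Sup k - Inf k))"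
    proof (rule sum_mono)
      fix k assume "k \<in> d"
      have "(g (Sup k) - r * Sup k) - (g (Inf k) - r * Inf k) = (g (Sup k) - g (Inf k)) - r * (Sup k - Inf k)"
        by (simp add: algebra_simps)
      also have "\<bar>\<dots>\<bar> \<le> \<bar>g (Sup k) - g (Inf k)\<bar> + \<bar>r * (Sup k - Inf k)\<bar>" by (rule abs_triangle_ineq4)
      finally show "\<bar>(g (Sup k) - r * Sup k) - (g (Inf k) - r * Inf k)\<bar>
        \<le> \<bar>g (Sup k) - g (Inf k)\<bar> + \<bar>r\<bar> * (Sup k - Inf k)"
        using division_interval(2)[OF d(1) \<open>k \<in> d\<close>] by (simp add: abs_mult)
    qed
    also have "\<dots> = (\<Sum>k\<in>d. \<bar>g (Sup k) - g (Inf k)\<bar>) + \<bar>r\<bar> * (\<Sum>k\<in>d. Sup k - Inf k)"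
      by (simp add: sum.distrib sum_distrib_left)
    also have "\<dots> \<le> M + \<bar>r\<bar> * (b - a)"
      using M[OF d] division_length_bound[OF d assms(2)] by (intro add_mono mult_left_mono) auto
    finally show ?thesis .
  qed
  then show ?thesis unfolding bounded_var_def by blast
qed

text \<open>\<open>V x\<close> is the total variation of \<open>g\<close> on \<open>{a..x}\<close>.
  Appending \<open>{x..y}\<close> to a family in \<open>{a..x}\<close> gives the first property; the
  second says that some division almost attains the total variation.\<close>

lemma bounded_var_majorant:
  assumes "bounded_var a b g" "a \<le> b"
  obtains V where "\<And>x y. a \<le> x \<Longrightarrow> x \<le> y \<Longrightarrow> y \<le> b \<Longrightarrow> \<bar>g y - g x\<bar> \<le> V y - V x"
    and "\<And>e. 0 < e \<Longrightarrow> \<exists>d. d division_of {a..b} \<and> (\<Sum>k\<in>d. V (Sup k) - V (Inf k) - \<bar>g (Sup k) - g (Inf k)\<bar>) < e"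
proof -
  obtain M where M: "\<And>d. d division_of \<Union>d \<Longrightarrow> \<Union>d \<subseteq> {a..b} \<Longrightarrow> (\<Sum>k\<in>d. \<bar>g (Sup k) - g (Inf k)\<bar>) \<le> M"
    using assms(1) unfolding bounded_var_def by blast
  define s where "s d = (\<Sum>k\<in>d. \<bar>g (Sup k) - g (Inf k)\<bar>)" for d
  define A where "A x = {d. d division_of \<Union>d \<and> \<Union>d \<subseteq> {a..x}}" for x
  define V where "V x = (SUP d\<in>A x. s d)" for x
  have ne: "A x \<noteq> {}" for x
    unfolding A_def by (auto intro!: exI[of _ "{}"])
  have bdd: "bdd_above (s ` A x)" if "x \<le> b" for x
  proof (rule bdd_aboveI2)
    fix d assume "d \<in> A x"
    then have "d division_of \<Union>d" "\<Union>d \<subseteq> {a..b}"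
      using that unfolding A_def by (auto simp: subset_iff)
    then show "s d \<le> M" unfolding s_def by (rule M)
  qed
  have up: "s d \<le> V x" if "d \<in> A x" "x \<le> b" for d x
    unfolding V_def using bdd[OF that(2)] that(1) by (rule cSUP_upper2) auto
  have super: "\<bar>g y - g x\<bar> \<le> V y - V x" if xy: "a \<le> x" "x \<le> y" "y \<le> b" for x y
  proof -
    have "V x \<le> V y - \<bar>g y - g x\<bar>"
      unfolding V_def[of x]
    proof (rule cSUP_least[OF ne])
      fix d assume d: "d \<in> A x"
      show "s d \<le> V y - \<bar>g y - g x\<bar>"
      proof (cases "x = y")
        case True
        then show ?thesis using up[OF d] xy by simp
      next
        case False
        with xy have lt: "x < y" by simp
        have dd: "d division_of \<Union>d" and sub: "\<Union>d \<subseteq> {a..x}" using d unfolding A_def by auto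
        \<comment> \<open>If the new interval already belonged to \<open>d\<close>, inserting it
          would not add the summand for \<open>{x..y}\<close>.\<close>
        have nin: "{x..y} \<notin> d"
        proof
          assume "{x..y} \<in> d"
          then have "y \<in> \<Union>d" using lt by (intro UnionI[of "{x..y}"]) auto
          then show False using sub lt by auto
        qed
        have fin: "finite d" using dd by auto
        have "insert {x..y} d division_of \<Union>(insert {x..y} d)"
        proof (rule division_ofI)
          show "finite (insert {x..y} d)" using fin by simp
          fix K assume K: "K \<in> insert {x..y} d"
          then show "K \<noteq> {}" "\<exists>a b. K = cbox a b" "K \<subseteq> \<Union> (insert {x..y} d)"
            using division_ofD(3,4)[OF dd] lt by auto
          fix K' assume K': "K' \<in> insert {x..y} d" "K \<noteq> K'"
          have *: "interior J \<inter> interior {x..y} = {}" if "J \<in> d" for J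
          proof -
            have "interior J \<subseteq> interior {a..x}" using that sub by (intro interior_mono) auto
            then show ?thesis by auto
          qed
          show "interior K \<inter> interior K' = {}"
            using K K' * division_ofD(5)[OF dd] by blast
        qed auto
        moreover have "\<Union>(insert {x..y} d) \<subseteq> {a..y}" using sub xy by auto
        ultimately have "insert {x..y} d \<in> A y" unfolding A_def by blast
        from up[OF this xy(3)] have "s (insert {x..y} d) \<le> V y" .
        moreover have "s (insert {x..y} d) = \<bar>g y - g x\<bar> + s d"
          unfolding s_def using fin nin lt by simp
        ultimately show ?thesis by simp
      qed
    qed
    then show ?thesis by simp
  qed
  have Va: "V a = 0"
  proof -
    have "s d = 0" if "d \<in> A a" for d
      unfolding s_def
    proof (rule sum.neutral, rule ballI)
      fix k assume "k \<in> d"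
      with that have "Inf k \<in> {a..a}" "Sup k \<in> {a..a}"
        using division_interval(3,4)[of d "\<Union>d" k] unfolding A_def by auto
      then show "\<bar>g (Sup k) - g (Inf k)\<bar> = 0" by simp
    qed
    then have "s ` A a = {0}" using ne[of a] by auto
    then show ?thesis unfolding V_def by simp
  qed
  have near: "\<exists>d. d division_of {a..b} \<and> (\<Sum>k\<in>d. V (Sup k) - V (Inf k) - \<bar>g (Sup k) - g (Inf k)\<bar>) < e"
    if "0 < e" for e
  proof -
    have "\<exists>d\<in>A b. V b - e < s d"
      using less_cSUP_iff[OF ne bdd[OF order_refl], of "V b - e"] that V_def[of b] by simp
    then obtain d where d: "d \<in> A b" "V b - e < s d" by blast
    then obtain q where q: "d \<subseteq> q" "q division_of {a..b}"
      using partial_division_extend_interval[of d a b] unfolding A_def by auto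
    \<comment> \<open>Completing \<open>d\<close> to a division only increases the sum, and over a
      division the increments of \<open>V\<close> telescope to \<open>V b\<close>.\<close>
    have "s d \<le> s q"
      unfolding s_def by (rule sum_mono2) (use q in auto)
    then have "(\<Sum>k\<in>q. V (Sup k) - V (Inf k) - \<bar>g (Sup k) - g (Inf k)\<bar>) < e"
      using division_sum_endpoints[OF q(2) assms(2), of V] d(2) Va
      unfolding s_def sum_subtractf by simp
    with q(2) show ?thesis by blast
  qed
  show ?thesis using that[OF super near] .
qed

text \<open>A difference quotient is symmetric in its two points. So on whichever side of
  \<open>x\<close> the second point lies, the quotient is the slope over a short interval with
  \<open>x\<close> as an end point, and one-sided derivates need not be distinguished.\<close>

lemma slope_interval:
  fixes g :: "real \<Rightarrow> real"
  assumes "\<exists>\<^sub>F y in at x. P ((g y - g x) / (y - x))" "0 < e"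
  obtains u v where "u < v" "x \<in> {u..v}" "v - u < e" "P ((g v - g u) / (v - u))"
proof -
  have "\<not> (\<forall>y. y \<noteq> x \<and> dist y x < e \<longrightarrow> \<not> P ((g y - g x) / (y - x)))"
    using assms unfolding frequently_def eventually_at by auto
  then obtain y where y: "y \<noteq> x" "dist y x < e" "P ((g y - g x) / (y - x))" by blast
  show ?thesis
  proof (cases "x < y")
    case True
    then show ?thesis using y that[of x y] by (auto simp: dist_real_def)
  next
    case False
    have "(g y - g x) / (y - x) = (g x - g y) / (x - y)"
      by (metis minus_diff_eq minus_divide_divide)
    then show ?thesis using False y that[of y x] by (auto simp: dist_real_def)
  qed
qed

text \<open>On a division almost attaining the total variation, \<open>g\<close> can move only little against the
  direction of its increment over a member of the division.\<close>

lemma bounded_var_oscillation_negligible: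
  assumes bv: "bounded_var a b g" and ab: "a \<le> b" and c: "0 < c"
  shows "negligible {x \<in> {a<..<b}. (\<exists>\<^sub>F y in at x. (g y - g x) / (y - x) < - c) \<and>
                                   (\<exists>\<^sub>F y in at x. (g y - g x) / (y - x) > c)}"
    (is "negligible ?E")
  unfolding negligible_outer_le
proof (intro allI impI)
  fix e :: real assume e: "0 < e"
  obtain V where V: "\<And>x y. a \<le> x \<Longrightarrow> x \<le> y \<Longrightarrow> y \<le> b \<Longrightarrow> \<bar>g y - g x\<bar> \<le> V y - V x"
    and near: "\<And>e. 0 < e \<Longrightarrow> \<exists>d. d division_of {a..b} \<and> (\<Sum>k\<in>d. V (Sup k) - V (Inf k) - \<bar>g (Sup k) - g (Inf k)\<bar>) < e"
    using bounded_var_majorant[OF bv ab] by blast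
  obtain d where d: "d division_of {a..b}"
    and dn: "(\<Sum>k\<in>d. V (Sup k) - V (Inf k) - \<bar>g (Sup k) - g (Inf k)\<bar>) < 2 * c * e"
    using near[of "2 * c * e"] c e by auto
  \<comment> \<open>\<open>\<sigma> k\<close> is the direction of \<open>g\<close> over the member
    \<open>k\<close>. The function \<open>W k\<close> increases on \<open>k\<close>, and its
    increments over all members add up to the variation deficit, which is below
    \<open>2 * c * e\<close>. On an interval of \<open>K\<close>, \<open>g\<close> moves against
    \<open>\<sigma> k\<close> with slope at least \<open>c\<close>; there both \<open>V\<close> and
    \<open>- \<sigma> k * g\<close> gain \<open>c\<close> times the length, so \<open>W k\<close>
    gains twice that.\<close>
  define \<sigma> where "\<sigma> k = (if g (Inf k) \<le> g (Sup k) then 1 else -1 :: real)" for k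
  define W where "W k x = V x - \<sigma> k * g x" for k x
  define K where "K = {{u..v} |u v. u < v \<and> (\<exists>k\<in>d. {u..v} \<subseteq> k \<and> \<sigma> k * (g v - g u) \<le> - c * (v - u))}"
  have fin: "finite d" using d by auto
  \<comment> \<open>At an end point of a member no short interval around the point need fit into
    that member. These finitely many points are set aside and put back at the end.\<close>
  let ?S = "?E - (Inf ` d \<union> Sup ` d)"
  obtain T where T: "?S \<subseteq> T" "T \<in> lmeasurable" "measure lebesgue T \<le> e"
  proof (rule Vitali_interval_cover[of K ?S e])
    show "\<exists>u v. u < v \<and> k = {u..v}" if "k \<in> K" for k using that unfolding K_def by blast
  next
    fix x \<delta> :: real assume x: "x \<in> ?S" and \<delta>: "0 < \<delta>"
    then have "x \<in> \<Union>d" using division_ofD(6)[OF d] by auto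
    then obtain k where k: "k \<in> d" "x \<in> k" by blast
    have k': "k = {Inf k..Sup k}" using division_interval[OF d k(1)] by blast
    have "Inf k < x" "x < Sup k" using x k k' by (auto simp: less_le)
    define \<eta> where "\<eta> = min \<delta> (min (x - Inf k) (Sup k - x))"
    have \<eta>: "0 < \<eta>" using \<open>Inf k < x\<close> \<open>x < Sup k\<close> \<delta> unfolding \<eta>_def by auto
    have "\<exists>u v. u < v \<and> x \<in> {u..v} \<and> v - u < \<eta> \<and> \<sigma> k * (g v - g u) \<le> - c * (v - u)"
    proof (cases "\<sigma> k = 1")
      case True
      have "\<exists>\<^sub>F y in at x. (g y - g x) / (y - x) < - c" using x by simp
      from slope_interval[where P="\<lambda>t. t < -c", OF this \<eta>]
      obtain u v where "u < v" "x \<in> {u..v}" "v - u < \<eta>" "(g v - g u) / (v - u) < - c" by blast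
      then show ?thesis using True by (intro exI[of _ u] exI[of _ v]) (auto simp: field_simps)
    next
      case False
      then have s: "\<sigma> k = -1" unfolding \<sigma>_def by (auto split: if_splits)
      have "\<exists>\<^sub>F y in at x. (g y - g x) / (y - x) > c" using x by simp
      from slope_interval[where P="\<lambda>t. t > c", OF this \<eta>]
      obtain u v where "u < v" "x \<in> {u..v}" "v - u < \<eta>" "(g v - g u) / (v - u) > c" by blast
      then show ?thesis using s by (intro exI[of _ u] exI[of _ v]) (auto simp: field_simps)
    qed
    then obtain u v where uv: "u < v" "x \<in> {u..v}" "v - u < \<eta>" "\<sigma> k * (g v - g u) \<le> - c * (v - u)"
      by blast
    have "{u..v} \<subseteq> k" using uv unfolding \<eta>_def by (subst k') auto
    then have "{u..v} \<in> K" unfolding K_def using uv k by blast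
    then show "\<exists>k\<in>K. x \<in> k \<and> Sup k - Inf k < \<delta>"
      using uv unfolding \<eta>_def by (intro bexI[of _ "{u..v}"]) auto
  next
    fix d' assume d': "d' division_of \<Union>d'" and sub: "d' \<subseteq> K"
    have fin': "finite d'" using d' by auto
    have ex: "\<exists>k\<in>d. J \<subseteq> k \<and> \<sigma> k * (g (Sup J) - g (Inf J)) \<le> - c * (Sup J - Inf J)"
      if "J \<in> d'" for J
    proof -
      have "J \<in> K" using that sub by blast
      then obtain u v k where "J = {u..v}" "u < v" "k \<in> d" "J \<subseteq> k" "\<sigma> k * (g v - g u) \<le> - c * (v - u)"
        unfolding K_def by blast
      then show ?thesis by (intro bexI[of _ k]) auto
    qed
    then obtain \<kappa> where \<kappa>: "\<And>J. J \<in> d' \<Longrightarrow> \<kappa> J \<in> d" "\<And>J. J \<in> d' \<Longrightarrow> J \<subseteq> \<kappa> J"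
        "\<And>J. J \<in> d' \<Longrightarrow> \<sigma> (\<kappa> J) * (g (Sup J) - g (Inf J)) \<le> - c * (Sup J - Inf J)"
      by metis
    have ends: "a \<le> Inf k" "Inf k \<le> Sup k" "Sup k \<le> b" "k = {Inf k..Sup k}" if "k \<in> d" for k
      using division_interval[OF d that] by auto
    have "2 * c * (\<Sum>J\<in>d'. Sup J - Inf J) = (\<Sum>J\<in>d'. 2 * c * (Sup J - Inf J))"
      by (simp add: sum_distrib_left)
    also have "\<dots> \<le> (\<Sum>J\<in>d'. W (\<kappa> J) (Sup J) - W (\<kappa> J) (Inf J))"
    proof (rule sum_mono)
      fix J assume J: "J \<in> d'"
      have iJ: "Inf J \<le> Sup J" "Inf J \<in> J" "Sup J \<in> J"
        using division_interval(2,5,6)[OF d' J] by auto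
      then have "Inf J \<in> {a..b}" "Sup J \<in> {a..b}"
        using \<kappa>(2)[OF J] division_ofD(2)[OF d \<kappa>(1)[OF J]] by blast+
      then have v: "\<bar>g (Sup J) - g (Inf J)\<bar> \<le> V (Sup J) - V (Inf J)"
        using V[of "Inf J" "Sup J"] iJ(1) by simp
      have "c * (Sup J - Inf J) \<le> - (\<sigma> (\<kappa> J) * (g (Sup J) - g (Inf J)))"
        using \<kappa>(3)[OF J] by simp
      moreover have "- (\<sigma> (\<kappa> J) * (g (Sup J) - g (Inf J))) \<le> \<bar>g (Sup J) - g (Inf J)\<bar>"
        unfolding \<sigma>_def by auto
      ultimately show "2 * c * (Sup J - Inf J) \<le> W (\<kappa> J) (Sup J) - W (\<kappa> J) (Inf J)"
        using v unfolding W_def by (simp add: algebra_simps)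
    qed
    \<comment> \<open>The small intervals are sorted by the member that contains them, since
      \<open>W\<close> depends on that member and is monotone only there.\<close>
    also have "\<dots> = (\<Sum>k\<in>d. \<Sum>J\<in>{J\<in>d'. \<kappa> J = k}. W (\<kappa> J) (Sup J) - W (\<kappa> J) (Inf J))"
      by (rule sum.group[symmetric]) (use fin fin' \<kappa>(1) in auto)
    also have "\<dots> = (\<Sum>k\<in>d. \<Sum>J\<in>{J\<in>d'. \<kappa> J = k}. W k (Sup J) - W k (Inf J))"
      by (intro sum.cong) auto
    also have "\<dots> \<le> (\<Sum>k\<in>d. W k (Sup k) - W k (Inf k))"
    proof (rule sum_mono)
      fix k assume k: "k \<in> d"
      show "(\<Sum>J\<in>{J\<in>d'. \<kappa> J = k}. W k (Sup J) - W k (Inf J)) \<le> W k (Sup k) - W k (Inf k)"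
      proof (rule mono_sum_division_le)
        show "mono_on {Inf k..Sup k} (W k)"
        proof (rule mono_onI)
          fix r s assume rs: "r \<in> {Inf k..Sup k}" "s \<in> {Inf k..Sup k}" "r \<le> s"
          then have "\<bar>g s - g r\<bar> \<le> V s - V r" using ends(1,3)[OF k] by (intro V) auto
          moreover have "\<sigma> k * (g s - g r) \<le> \<bar>g s - g r\<bar>" unfolding \<sigma>_def by auto
          ultimately show "W k r \<le> W k s" unfolding W_def by (simp add: algebra_simps)
        qed
        show "{J\<in>d'. \<kappa> J = k} division_of \<Union>{J\<in>d'. \<kappa> J = k}"
          by (rule division_of_subset[OF d']) auto
        show "\<Union>{J\<in>d'. \<kappa> J = k} \<subseteq> {Inf k..Sup k}"
          using \<kappa>(2) by (subst ends(4)[OF k, symmetric]) blast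
      qed (rule ends(2)[OF k])
    qed
    also have "\<dots> = (\<Sum>k\<in>d. V (Sup k) - V (Inf k) - \<bar>g (Sup k) - g (Inf k)\<bar>)"
    proof (rule sum.cong[OF refl])
      fix k
      have "\<sigma> k * (g (Sup k) - g (Inf k)) = \<bar>g (Sup k) - g (Inf k)\<bar>" unfolding \<sigma>_def by auto
      then show "W k (Sup k) - W k (Inf k) = V (Sup k) - V (Inf k) - \<bar>g (Sup k) - g (Inf k)\<bar>"
        unfolding W_def by (simp add: algebra_simps)
    qed
    also have "\<dots> < 2 * c * e" by (rule dn)
    finally have "2 * c * (\<Sum>J\<in>d'. Sup J - Inf J) < 2 * c * e" .
    then show "(\<Sum>J\<in>d'. Sup J - Inf J) \<le> e" using c by simp
  qed blast
  let ?F = "Inf ` d \<union> Sup ` d"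
  have F: "finite ?F" using fin by simp
  show "\<exists>T. ?E \<subseteq> T \<and> T \<in> lmeasurable \<and> measure lebesgue T \<le> e"
  proof (intro exI conjI)
    show "?E \<subseteq> ?F \<union> T" using T(1) by blast
    have Fm: "?F \<in> lmeasurable" "measure lebesgue ?F = 0"
      using negligible_finite[OF F] by (simp_all add: negligible_imp_measurable negligible_imp_measure0)
    show "?F \<union> T \<in> lmeasurable" using Fm(1) T(2) by (rule fmeasurable.Un)
    show "measure lebesgue (?F \<union> T) \<le> e"
      using measure_Un_le[of ?F lebesgue T] T Fm by (simp add: fmeasurableD)
  qed
qed

text \<open>Disjoint intervals of slope above \<open>n\<close> have total length at most
  \<open>M / n\<close>, where \<open>M\<close> bounds the variation, and \<open>n\<close> is
  arbitrary.\<close>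

lemma bounded_var_infinite_slope_negligible:
  assumes bv: "bounded_var a b g"
  shows "negligible {x \<in> {a<..<b}. \<forall>n::nat. \<exists>\<^sub>F y in at x. \<bar>(g y - g x) / (y - x)\<bar> > real n}"
    (is "negligible ?E")
  unfolding negligible_outer_le
proof (intro allI impI)
  fix e :: real assume e: "0 < e"
  obtain M where M: "\<And>d. d division_of \<Union>d \<Longrightarrow> \<Union>d \<subseteq> {a..b} \<Longrightarrow> (\<Sum>k\<in>d. \<bar>g (Sup k) - g (Inf k)\<bar>) \<le> M"
    using bv unfolding bounded_var_def by blast
  obtain n :: nat where n: "M / e < n" "0 < n"
    using reals_Archimedean2[of "max 0 (M / e)"] by (metis max_less_iff_conj of_nat_0_less_iff)
  define K where "K = {{u..v} |u v. u < v \<and> {u..v} \<subseteq> {a..b} \<and> real n * (v - u) \<le> \<bar>g v - g u\<bar>}"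
  obtain T where T: "?E \<subseteq> T" "T \<in> lmeasurable" "measure lebesgue T \<le> e"
  proof (rule Vitali_interval_cover[of K ?E e])
    show "\<exists>u v. u < v \<and> k = {u..v}" if "k \<in> K" for k using that unfolding K_def by blast
  next
    fix x \<delta> :: real assume x: "x \<in> ?E" and \<delta>: "0 < \<delta>"
    define \<eta> where "\<eta> = min \<delta> (min (x - a) (b - x))"
    have \<eta>: "0 < \<eta>" using x \<delta> unfolding \<eta>_def by auto
    have "\<exists>\<^sub>F y in at x. \<bar>(g y - g x) / (y - x)\<bar> > real n" using x by blast
    from slope_interval[where P="\<lambda>t. \<bar>t\<bar> > real n", OF this \<eta>]
    obtain u v where uv: "u < v" "x \<in> {u..v}" "v - u < \<eta>" "\<bar>(g v - g u) / (v - u)\<bar> > real n" by blast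
    then have "{u..v} \<in> K" unfolding K_def \<eta>_def
      by (intro CollectI exI[of _ u] exI[of _ v]) (auto simp: field_simps)
    then show "\<exists>k\<in>K. x \<in> k \<and> Sup k - Inf k < \<delta>"
      using uv unfolding \<eta>_def by (intro bexI[of _ "{u..v}"]) auto
  next
    fix d' assume d': "d' division_of \<Union>d'" and sub: "d' \<subseteq> K"
    have "n * (\<Sum>J\<in>d'. Sup J - Inf J) = (\<Sum>J\<in>d'. n * (Sup J - Inf J))"
      by (simp add: sum_distrib_left)
    also have "\<dots> \<le> (\<Sum>J\<in>d'. \<bar>g (Sup J) - g (Inf J)\<bar>)"
    proof (rule sum_mono)
      fix J assume "J \<in> d'"
      then have "J \<in> K" using sub by blast
      then show "n * (Sup J - Inf J) \<le> \<bar>g (Sup J) - g (Inf J)\<bar>" unfolding K_def by auto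
    qed
    also have "\<dots> \<le> M" using sub unfolding K_def by (intro M[OF d']) auto
    also have "M \<le> n * e" using n e by (simp add: field_simps)
    finally show "(\<Sum>J\<in>d'. Sup J - Inf J) \<le> e" using n(2) by simp
  qed blast
  then show "\<exists>T. ?E \<subseteq> T \<and> T \<in> lmeasurable \<and> measure lebesgue T \<le> e" by blast
qed

text \<open>The limit is the lower limit, the supremum of all eventual strict lower bounds. Only
  rational gaps are tested, so that the application meets countably many exceptional sets.\<close>

lemma bounded_oscillation_imp_tendsto:
  fixes S :: "'a \<Rightarrow> real"
  assumes ne: "F \<noteq> bot" and bdd: "\<forall>\<^sub>F y in F. \<bar>S y\<bar> \<le> M"
    and osc: "\<And>r s. r \<in> \<rat> \<Longrightarrow> s \<in> \<rat> \<Longrightarrow> r < s \<Longrightarrow> (\<exists>\<^sub>F y in F. S y < r) \<Longrightarrow> (\<exists>\<^sub>F y in F. S y > s) \<Longrightarrow> False"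
  shows "\<exists>L. (S \<longlongrightarrow> L) F"
proof -
  define A where "A = {r. \<forall>\<^sub>F y in F. S y > r}"
  have neA: "A \<noteq> {}"
  proof -
    have "- M - 1 \<in> A" unfolding A_def mem_Collect_eq using bdd by eventually_elim auto
    then show ?thesis by blast
  qed
  have bA: "bdd_above A"
  proof (rule bdd_aboveI)
    fix r assume "r \<in> A"
    then have "\<forall>\<^sub>F y in F. S y > r \<and> \<bar>S y\<bar> \<le> M" unfolding A_def using bdd by (simp add: eventually_conj)
    then obtain y where "S y > r" "\<bar>S y\<bar> \<le> M" using ne eventually_happens by blast
    then show "r \<le> M" by auto
  qed
  have "(S \<longlongrightarrow> Sup A) F"
  proof (rule order_tendstoI)
    fix r assume "r < Sup A"
    then obtain t where "t \<in> A" "r < t" using less_cSup_iff[OF neA bA] by blast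
    then show "\<forall>\<^sub>F y in F. r < S y" unfolding A_def by (auto elim: eventually_mono)
  next
    fix s assume "Sup A < s"
    \<comment> \<open>The chain is Sup A < q < r < p < q' < s. That \<open>q\<close> is no eventual
      lower bound gives only values \<open>\<le> q\<close>, so \<open>r\<close> restores strictness;
      excluding values above \<open>q'\<close> gives only \<open>\<le> q'\<close>, so
      \<open>s\<close> does the same.\<close>
    then obtain p where p: "Sup A < p" "p < s" using dense by blast
    obtain q where q: "q \<in> \<rat>" "Sup A < q" "q < p" using Rats_dense_in_real[OF p(1)] by blast
    obtain q' where q': "q' \<in> \<rat>" "p < q'" "q' < s" using Rats_dense_in_real[OF p(2)] by blast
    obtain r where r: "r \<in> \<rat>" "q < r" "r < p" using Rats_dense_in_real[OF q(3)] by blast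
    have "q \<notin> A" using q(2) cSup_upper[OF _ bA] by force
    then have "\<exists>\<^sub>F y in F. S y \<le> q" unfolding A_def frequently_def by (simp add: not_le)
    then have "\<exists>\<^sub>F y in F. S y < r" by (rule frequently_elim1) (use r in auto)
    then have "\<not> (\<exists>\<^sub>F y in F. S y > q')" using osc[of r q'] r q' by auto
    then have "\<forall>\<^sub>F y in F. S y \<le> q'" unfolding frequently_def by (simp add: not_less)
    then show "\<forall>\<^sub>F y in F. S y < s" by eventually_elim (use q' in auto)
  qed
  then show ?thesis by blast
qed

text \<open>Where no derivative exists, the difference quotients are either unbounded or oscillate
  across a gap with rational ends. The first kind of point forms one null set, the second a
  countable union of null sets.\<close>

theorem bounded_var_differentiable_ae:
  assumes bv: "bounded_var a b g" and ab: "a \<le> b"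
  shows "negligible {x \<in> {a<..<b}. \<not> g differentiable (at x)}"
proof -
  define E where "E r c = {x \<in> {a<..<b}. (\<exists>\<^sub>F y in at x. ((g y - r * y) - (g x - r * x)) / (y - x) < - c) \<and>
                                   (\<exists>\<^sub>F y in at x. ((g y - r * y) - (g x - r * x)) / (y - x) > c)}" for r c :: real
  define U where "U = {x \<in> {a<..<b}. \<forall>n::nat. \<exists>\<^sub>F y in at x. \<bar>(g y - g x) / (y - x)\<bar> > real n}"
  let ?I = "\<rat> \<times> (\<rat> \<inter> {0<..})"
  have nE: "negligible (E r c)" if "0 < c" for r c
    unfolding E_def using bounded_var_oscillation_negligible[OF bounded_var_diff_linear[OF bv ab, of r] ab that] .
  have "negligible (\<Union>(r,c)\<in>?I. E r c)"
    by (rule negligible_countable_Union) (use nE countable_rat in \<open>auto intro!: countable_SIGMA\<close>)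
  moreover have "negligible U"
    unfolding U_def by (rule bounded_var_infinite_slope_negligible[OF bv])
  ultimately have "negligible ((\<Union>(r,c)\<in>?I. E r c) \<union> U)" by (rule negligible_Un)
  then show ?thesis
  proof (rule negligible_subset)
    show "{x \<in> {a<..<b}. \<not> g differentiable (at x)} \<subseteq> (\<Union>(r,c)\<in>?I. E r c) \<union> U"
    proof (intro subsetI, rule ccontr)
      fix x assume x: "x \<in> {x \<in> {a<..<b}. \<not> g differentiable (at x)}"
        and nx: "x \<notin> (\<Union>(r,c)\<in>?I. E r c) \<union> U"
      let ?S = "\<lambda>y. (g y - g x) / (y - x)"
      have "\<exists>L. (?S \<longlongrightarrow> L) (at x)"
      proof -
        obtain n :: nat where "\<not> (\<exists>\<^sub>F y in at x. \<bar>?S y\<bar> > real n)"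
          using nx x unfolding U_def by blast
        then have b: "\<forall>\<^sub>F y in at x. \<bar>?S y\<bar> \<le> real n" unfolding frequently_def by (simp add: not_less)
        show ?thesis
        proof (rule bounded_oscillation_imp_tendsto[OF _ b])
          fix r s :: real assume rs: "r \<in> \<rat>" "s \<in> \<rat>" "r < s" "\<exists>\<^sub>F y in at x. ?S y < r" "\<exists>\<^sub>F y in at x. ?S y > s"
          \<comment> \<open>Midpoint and half width of the gap: after subtracting the line of slope
            \<open>m\<close>, the quotients fall below \<open>- c\<close> and rise above
            \<open>c\<close>.\<close>
          define m c where "m = (r + s) / 2" and "c = (s - r) / 2"
          have mc: "(m, c) \<in> ?I" using rs unfolding m_def c_def by auto
          have eq: "((g y - m * y) - (g x - m * x)) / (y - x) = ?S y - m" if "y \<noteq> x" for y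
            using that by (simp add: field_simps)
          have ne: "\<forall>\<^sub>F y in at x. y \<noteq> x" by (simp add: eventually_at_filter)
          have "\<exists>\<^sub>F y in at x. ((g y - m * y) - (g x - m * x)) / (y - x) < - c"
          proof (rule frequently_rev_mp[OF rs(4)])
            show "\<forall>\<^sub>F y in at x. ?S y < r \<longrightarrow> ((g y - m * y) - (g x - m * x)) / (y - x) < - c"
              using ne
            proof eventually_elim
              case (elim y)
              have "r - m = - c" unfolding m_def c_def by (simp add: field_simps)
              then show ?case using eq[OF elim] by linarith
            qed
          qed
          moreover have "\<exists>\<^sub>F y in at x. ((g y - m * y) - (g x - m * x)) / (y - x) > c"
          proof (rule frequently_rev_mp[OF rs(5)])
            show "\<forall>\<^sub>F y in at x. ?S y > s \<longrightarrow> ((g y - m * y) - (g x - m * x)) / (y - x) > c"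
              using ne
            proof eventually_elim
              case (elim y)
              have "s - m = c" unfolding m_def c_def by (simp add: field_simps)
              then show ?case using eq[OF elim] by linarith
            qed
          qed
          ultimately have "x \<in> E m c" using x unfolding E_def by blast
          then show False using mc nx by blast
        qed simp
      qed
      then obtain L where "(?S \<longlongrightarrow> L) (at x)" by blast
      then have "(g has_field_derivative L) (at x)" by (simp add: has_field_derivative_iff)
      then have "g differentiable (at x)" by (auto simp: real_differentiable_def)
      then show False using x by simp
    qed
  qed
qed

section \<open>The fundamental theorem of calculus for absolutely continuous functions\<close>

lemma abs_cont_onD:
  assumes "abs_cont_on a b f" "0 < \<epsilon>"
  obtains \<delta> where "0 < \<delta>"
    "\<And>d. d division_of \<Union>d \<Longrightarrow> \<Union>d \<subseteq> {a..b} \<Longrightarrow> (\<Sum>k\<in>d. Sup k - Inf k) < \<delta>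
        \<Longrightarrow> (\<Sum>k\<in>d. norm (f (Sup k) - f (Inf k))) < \<epsilon>"
proof -
  from assms have "\<exists>\<delta>>0. \<forall>d. d division_of \<Union>d \<and> \<Union>d \<subseteq> {a..b} \<and> (\<Sum>k\<in>d. Sup k - Inf k) < \<delta>
        \<longrightarrow> (\<Sum>k\<in>d. norm (f (Sup k) - f (Inf k))) < \<epsilon>"
    unfolding abs_cont_on_def by simp
  then show ?thesis using that by auto
qed

lemma abs_cont_on_continuous:
  assumes "abs_cont_on a b f"
  shows "continuous_on {a..b} f"
  unfolding continuous_on_iff
proof (intro ballI allI impI)
  fix x \<epsilon> :: real assume x: "x \<in> {a..b}" and "0 < \<epsilon>"
  from abs_cont_onD[OF assms this(2)]
  obtain \<delta> where \<delta>: "0 < \<delta>" "\<And>d. d division_of \<Union>d \<Longrightarrow> \<Union>d \<subseteq> {a..b} \<Longrightarrow> (\<Sum>k\<in>d. Sup k - Inf k) < \<delta>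
        \<Longrightarrow> (\<Sum>k\<in>d. norm (f (Sup k) - f (Inf k))) < \<epsilon>" by blast
  have *: "norm (f v - f u) < \<epsilon>" if "u \<in> {a..b}" "v \<in> {a..b}" "u \<le> v" "v - u < \<delta>" for u v
  proof -
    have "{{u..v}} division_of \<Union>{{u..v}}" using that(3) by (auto simp: division_of_self[of u v, simplified])
    from \<delta>(2)[OF this] that show ?thesis by auto
  qed
  show "\<exists>d>0. \<forall>x'\<in>{a..b}. dist x' x < d \<longrightarrow> dist (f x') (f x) < \<epsilon>"
  proof (intro exI[of _ \<delta>] conjI ballI impI)
    fix y assume y: "y \<in> {a..b}" "dist y x < \<delta>"
    show "dist (f y) (f x) < \<epsilon>"
      using *[of x y] *[of y x] x y by (cases "x \<le> y") (auto simp: dist_norm norm_minus_commute)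
  qed fact
qed

text \<open>On an interval shorter than the \<delta> belonging to \<epsilon> = 1, every family has
  total length below \<delta>, so 1 bounds the variation. Short intervals suffice because
  differentiability is local, and no family has to be cut at partition points.\<close>

lemma abs_cont_on_bounded_var:
  assumes "abs_cont_on a b f"
  obtains \<delta> where "0 < \<delta>"
    "\<And>p q. a \<le> p \<Longrightarrow> p \<le> q \<Longrightarrow> q \<le> b \<Longrightarrow> q - p < \<delta> \<Longrightarrow> bounded_var p q (\<lambda>x. Re (f x)) \<and> bounded_var p q (\<lambda>x. Im (f x))"
proof -
  obtain \<delta> where \<delta>: "0 < \<delta>" "\<And>d. d division_of \<Union>d \<Longrightarrow> \<Union>d \<subseteq> {a..b} \<Longrightarrow> (\<Sum>k\<in>d. Sup k - Inf k) < \<delta>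
        \<Longrightarrow> (\<Sum>k\<in>d. norm (f (Sup k) - f (Inf k))) < 1"
    using abs_cont_onD[OF assms zero_less_one] by blast
  have "bounded_var p q (\<lambda>x. Re (f x)) \<and> bounded_var p q (\<lambda>x. Im (f x))"
    if pq: "a \<le> p" "p \<le> q" "q \<le> b" "q - p < \<delta>" for p q
  proof -
    have 1: "(\<Sum>k\<in>d. norm (f (Sup k) - f (Inf k))) < 1" if d: "d division_of \<Union>d" "\<Union>d \<subseteq> {p..q}" for d
    proof (rule \<delta>(2)[OF d(1)])
      show "\<Union>d \<subseteq> {a..b}" using d(2) pq by auto
      show "(\<Sum>k\<in>d. Sup k - Inf k) < \<delta>" using division_length_bound[OF d pq(2)] pq(4) by simp
    qed
    have "(\<Sum>k\<in>d. \<bar>Re (f (Sup k)) - Re (f (Inf k))\<bar>) \<le> 1" "(\<Sum>k\<in>d. \<bar>Im (f (Sup k)) - Im (f (Inf k))\<bar>) \<le> 1"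
      if d: "d division_of \<Union>d" "\<Union>d \<subseteq> {p..q}" for d
    proof -
      have "(\<Sum>k\<in>d. \<bar>Re (f (Sup k)) - Re (f (Inf k))\<bar>) \<le> (\<Sum>k\<in>d. norm (f (Sup k) - f (Inf k)))"
        "(\<Sum>k\<in>d. \<bar>Im (f (Sup k)) - Im (f (Inf k))\<bar>) \<le> (\<Sum>k\<in>d. norm (f (Sup k) - f (Inf k)))"
        by (intro sum_mono; metis abs_Re_le_cmod minus_complex.simps(1) abs_Im_le_cmod minus_complex.simps(2))+
      with 1[OF d] show "(\<Sum>k\<in>d. \<bar>Re (f (Sup k)) - Re (f (Inf k))\<bar>) \<le> 1"
        "(\<Sum>k\<in>d. \<bar>Im (f (Sup k)) - Im (f (Inf k))\<bar>) \<le> 1" by linarith+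
    qed
    then show ?thesis unfolding bounded_var_def by blast
  qed
  with \<delta>(1) that show ?thesis by blast
qed

lemma abs_cont_on_differentiable_ae:
  assumes "abs_cont_on a b f"
  shows "negligible {x \<in> {a<..<b}. \<not> f differentiable (at x)}"
proof -
  obtain \<delta> where \<delta>: "0 < \<delta>"
    "\<And>p q. a \<le> p \<Longrightarrow> p \<le> q \<Longrightarrow> q \<le> b \<Longrightarrow> q - p < \<delta> \<Longrightarrow> bounded_var p q (\<lambda>x. Re (f x)) \<and> bounded_var p q (\<lambda>x. Im (f x))"
    using abs_cont_on_bounded_var[OF assms] by blast
  define E where "E p q = {x \<in> {p<..<q}. \<not> (\<lambda>x. Re (f x)) differentiable (at x)} \<union>
                          {x \<in> {p<..<q}. \<not> (\<lambda>x. Im (f x)) differentiable (at x)}" for p q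
  let ?I = "(\<rat> \<times> \<rat>) \<inter> {(p, q). a \<le> p \<and> p \<le> q \<and> q \<le> b \<and> q - p < \<delta>}"
  have "negligible (\<Union>(p,q)\<in>?I. E p q)"
  proof (rule negligible_countable_Union)
    have "countable ?I" using countable_rat by (intro countable_Int1 countable_SIGMA) auto
    then show "countable ((\<lambda>(p, q). E p q) ` ?I)" by simp
    fix S assume "S \<in> (\<lambda>(p, q). E p q) ` ?I"
    then obtain p q where "S = E p q" "a \<le> p" "p \<le> q" "q \<le> b" "q - p < \<delta>" by auto
    then show "negligible S"
      unfolding E_def using \<delta>(2)[of p q]
      by (simp only:) (intro negligible_Un bounded_var_differentiable_ae; simp)
  qed
  then show ?thesis
  proof (rule negligible_subset)
    show "{x \<in> {a<..<b}. \<not> f differentiable (at x)} \<subseteq> (\<Union>(p,q)\<in>?I. E p q)"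
    proof (intro subsetI, rule ccontr)
      fix x assume x: "x \<in> {x \<in> {a<..<b}. \<not> f differentiable (at x)}" and nx: "x \<notin> (\<Union>(p,q)\<in>?I. E p q)"
      obtain p where p: "p \<in> \<rat>" "max a (x - \<delta>/2) < p" "p < x"
        using Rats_dense_in_real[of "max a (x - \<delta>/2)" x] x \<delta>(1) by auto
      obtain q where q: "q \<in> \<rat>" "x < q" "q < min b (x + \<delta>/2)"
        using Rats_dense_in_real[of x "min b (x + \<delta>/2)"] x \<delta>(1) by auto
      have "(p, q) \<in> ?I" using p q by auto
      then have "x \<notin> E p q" using nx by blast
      then obtain u v where "((\<lambda>x. Re (f x)) has_real_derivative u) (at x)" "((\<lambda>x. Im (f x)) has_real_derivative v) (at x)"
        using p q unfolding E_def real_differentiable_def by auto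
      then have "(f has_vector_derivative Complex u v) (at x)"
        by (simp add: has_vector_derivative_complex_iff)
      then show False using x differentiableI_vector by blast
    qed
  qed
qed

text \<open>The gauge treats two kinds of tags differently. At a tag outside the null set
  \<open>N\<close> it enforces differentiability up to a small error. At a tag in \<open>N\<close>
  it keeps the interval inside an open set of small measure, where absolute continuity makes the
  increments of \<open>f\<close> small; since \<open>f'\<close> is 0 there, nothing else is
  contributed.\<close>

theorem abs_cont_on_has_integral:
  assumes ac: "abs_cont_on a b f" and ab: "a \<le> b"
  shows "(D f has_integral f b - f a) {a..b}"
proof -
  \<comment> \<open>The end points belong to \<open>N\<close> because \<open>f\<close> is not
    controlled outside \<open>{a..b}\<close>, so a two-sided derivative may fail to exist
    there.\<close>
  define N where "N = {x \<in> {a<..<b}. \<not> f differentiable (at x)} \<union> {a, b}"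
  have N: "negligible N"
    unfolding N_def by (intro negligible_Un abs_cont_on_differentiable_ae[OF ac]) auto
  define f' where "f' x = (if x \<in> N then 0 else D f x)" for x
  have deriv: "(f has_vector_derivative f' x) (at x)" if "x \<in> {a..b}" "x \<notin> N" for x
    using that unfolding f'_def D_def N_def by (auto simp: vector_derivative_works less_le)
  have "(f' has_integral f b - f a) {a..b}"
    unfolding has_integral_real
  proof (intro allI impI)
    fix e :: real assume e: "0 < e"
    obtain \<delta> where \<delta>: "0 < \<delta>" "\<And>d. d division_of \<Union>d \<Longrightarrow> \<Union>d \<subseteq> {a..b} \<Longrightarrow> (\<Sum>k\<in>d. Sup k - Inf k) < \<delta>
        \<Longrightarrow> (\<Sum>k\<in>d. norm (f (Sup k) - f (Inf k))) < e / 2"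
      using abs_cont_onD[OF ac half_gt_zero[OF e]] by blast
    obtain U where U: "open U" "N \<subseteq> U" "U \<in> lmeasurable" "measure lebesgue U < \<delta>"
    proof -
      have Nm: "N \<in> lmeasurable" "measure lebesgue N = 0"
        using N by (simp_all add: negligible_imp_measurable negligible_imp_measure0)
      obtain T where T: "open T" "N \<subseteq> T" "T - N \<in> lmeasurable" "emeasure lebesgue (T - N) < ennreal \<delta>"
        using sets_lebesgue_outer_open[OF fmeasurableD[OF Nm(1)] \<delta>(1)] by blast
      have "T = (T - N) \<union> N" using T(2) by auto
      then have "T \<in> lmeasurable" "measure lebesgue T \<le> measure lebesgue (T - N)"
        using fmeasurable.Un[OF T(3) Nm(1)] measure_Un_le[of "T - N" lebesgue N] Nm T(3)
        by (simp_all add: fmeasurableD)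
      moreover have "measure lebesgue (T - N) < \<delta>"
        using T(3,4) \<delta>(1) by (simp add: emeasure_eq_measure2 ennreal_less_iff)
      ultimately show ?thesis using T that by auto
    qed
    \<comment> \<open>The added 1 keeps the quotient meaningful for \<open>a = b\<close> and the
      later inequality strict.\<close>
    define \<eta> where "\<eta> = e / (2 * (b - a + 1))"
    have \<eta>: "0 < \<eta>" "\<eta> * (b - a) < e / 2" using e ab unfolding \<eta>_def by (auto simp: field_simps)
    have "\<exists>r>0. (x \<in> N \<longrightarrow> ball x r \<subseteq> U) \<and> (x \<in> {a..b} - N \<longrightarrow>
         (\<forall>y. \<bar>y - x\<bar> < r \<longrightarrow> norm (f y - f x - (y - x) *\<^sub>R f' x) \<le> \<eta> * \<bar>y - x\<bar>))" for x
    proof (cases "x \<in> N")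
      case True
      then show ?thesis using U(1,2) open_contains_ball by blast
    next
      case False
      show ?thesis
      proof (cases "x \<in> {a..b}")
        case True
        then have "(f has_vector_derivative f' x) (at x)" using False deriv by blast
        then have "\<exists>r>0. \<forall>y. \<bar>y - x\<bar> < r \<longrightarrow> norm (f y - f x - (y - x) *\<^sub>R f' x) \<le> \<eta> * \<bar>y - x\<bar>"
          unfolding has_vector_derivative_def has_derivative_at_alt using \<eta>(1) by auto
        then show ?thesis using False by blast
      qed (use False in \<open>auto intro: exI[of _ 1]\<close>)
    qed
    then obtain r where r: "\<And>x. 0 < r x" "\<And>x. x \<in> N \<Longrightarrow> ball x (r x) \<subseteq> U"
      "\<And>x y. x \<in> {a..b} \<Longrightarrow> x \<notin> N \<Longrightarrow> \<bar>y - x\<bar> < r x \<Longrightarrow> norm (f y - f x - (y - x) *\<^sub>R f' x) \<le> \<eta> * \<bar>y - x\<bar>"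
      by (metis Diff_iff)
    let ?\<gamma> = "\<lambda>x. ball x (r x)"
    show "\<exists>\<gamma>. gauge \<gamma> \<and> (\<forall>p. p tagged_division_of {a..b} \<and> \<gamma> fine p \<longrightarrow>
            norm ((\<Sum>(x,k)\<in>p. measure lborel k *\<^sub>R f' x) - (f b - f a)) < e)"
    proof (intro exI conjI allI impI)
      show "gauge ?\<gamma>" using r(1) by (rule gauge_ball_dependent[rule_format])
      fix p assume "p tagged_division_of {a..b} \<and> ?\<gamma> fine p"
      then have p: "p tagged_division_of {a..b}" and fine: "?\<gamma> fine p" by auto
      have fin: "finite p" using p by auto
      let ?\<Delta> = "\<lambda>k. f (Sup k) - f (Inf k)"
      have K: "Inf k \<le> Sup k" "k = {Inf k..Sup k}" "x \<in> k" "x \<in> {a..b}" "k \<subseteq> ball x (r x)" "k \<subseteq> {a..b}"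
        "measure lborel k = Sup k - Inf k"
        if xk: "(x, k) \<in> p" for x k
      proof -
        obtain u v where k: "k = cbox u v" "x \<in> k" "k \<subseteq> {a..b}"
          using tagged_division_ofD(2,3,4)[OF p xk] by blast
        then have "u \<le> v" by auto
        then show "Inf k \<le> Sup k" "k = {Inf k..Sup k}" "measure lborel k = Sup k - Inf k" using k(1) by auto
        show "x \<in> k" "k \<subseteq> {a..b}" "x \<in> {a..b}" using k by auto
        show "k \<subseteq> ball x (r x)" using fine xk unfolding fine_def by auto
      qed
      have ne: "(x, {}) \<notin> p" for x using K(3)[of x "{}"] by blast
      define P where "P = {xk \<in> p. fst xk \<in> N}"
      have P: "P \<subseteq> p" "finite P" using fin unfolding P_def by auto
      have bad: "(\<Sum>(x,k)\<in>P. norm (measure lborel k *\<^sub>R f' x - ?\<Delta> k)) < e / 2"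
      proof -
        have part: "P tagged_partial_division_of {a..b}"
          using tagged_partial_division_subset[of p "{a..b}" P] p P(1) unfolding tagged_division_of_def by blast
        have div: "(snd ` P) division_of \<Union>(snd ` P)"
          using partial_division_of_tagged_division[OF part] .
        have sub: "\<Union>(snd ` P) \<subseteq> U" "\<Union>(snd ` P) \<subseteq> {a..b}"
          using K(5,6) r(2) unfolding P_def by fastforce+
        \<comment> \<open>Passing from tagged members to their set requires a function that vanishes
          on every interval with empty interior. For a single point the increment is 0; for the
          empty set, where \<open>Sup\<close> and \<open>Inf\<close> carry no information, the value
          0 is imposed.\<close>
        define h where "h k = (if k = {} then 0 else norm (?\<Delta> k))" for k
        have "(\<Sum>(x,k)\<in>P. norm (measure lborel k *\<^sub>R f' x - ?\<Delta> k)) = (\<Sum>(x,k)\<in>P. h k)"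
          using ne unfolding P_def h_def f'_def by (intro sum.cong) (auto simp: norm_minus_commute)
        also have "\<dots> = sum h (snd ` P)"
        proof (rule sum.over_tagged_division_lemma)
          show "P tagged_division_of \<Union>(snd ` P)"
            using tagged_partial_division_of_Union_self[OF part] .
          show "h (cbox u v) = 0" if "box u v = {}" for u v
          proof (cases "u = v")
            case False
            then have "cbox u v = {}" using that by (auto simp: box_eq_empty)
            then show ?thesis unfolding h_def by simp
          qed (simp add: h_def)
        qed
        also have "\<dots> = (\<Sum>k\<in>snd ` P. norm (?\<Delta> k))"
          using ne P(1) unfolding h_def by (intro sum.cong) auto
        also have "\<dots> < e / 2"
        proof (rule \<delta>(2)[OF div sub(2)])
          have "measure lebesgue (\<Union>(snd ` P)) \<le> measure lebesgue U"
          proof (rule measure_mono_fmeasurable[OF sub(1) _ U(3)])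
            have "\<Union>(snd ` P) \<in> lmeasurable" using div
              using lmeasurable_division by blast
            then show "\<Union>(snd ` P) \<in> sets lebesgue" by (rule fmeasurableD)
          qed
          then show "(\<Sum>k\<in>snd ` P. Sup k - Inf k) < \<delta>"
            using division_measure_Union[OF div] U(4) by simp
        qed
        finally show ?thesis .
      qed
      have good: "(\<Sum>(x,k)\<in>p - P. norm (measure lborel k *\<^sub>R f' x - ?\<Delta> k)) \<le> \<eta> * (b - a)"
      proof -
        have "(\<Sum>(x,k)\<in>p - P. norm (measure lborel k *\<^sub>R f' x - ?\<Delta> k)) \<le> (\<Sum>(x,k)\<in>p - P. \<eta> * (Sup k - Inf k))"
        proof (rule sum_mono, clarify)
          fix x k assume xk: "(x, k) \<in> p" "(x, k) \<notin> P"
          then have xN: "x \<notin> N" unfolding P_def by auto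
          note K = K[OF xk(1)]
          define u v where "u = Inf k" and "v = Sup k"
          have uv: "u \<le> v" "k = {u..v}" using K(1,2) unfolding u_def v_def by auto
          then have m: "u \<le> x" "x \<le> v" using K(3) by auto
          have b: "u \<in> ball x (r x)" "v \<in> ball x (r x)" using K(5) uv by auto
          have "norm (f u - f x - (u - x) *\<^sub>R f' x) \<le> \<eta> * \<bar>u - x\<bar>"
            "norm (f v - f x - (v - x) *\<^sub>R f' x) \<le> \<eta> * \<bar>v - x\<bar>"
            using b by (auto intro!: r(3) K(4) xN simp: dist_real_def)
          \<comment> \<open>The tag lies between \<open>u\<close> and \<open>v\<close>, so the
            linear errors on its two sides, proportional to the distances, add up to a multiple of
            the length of the member.\<close>
          moreover have "norm ((f u - f x - (u - x) *\<^sub>R f' x) - (f v - f x - (v - x) *\<^sub>R f' x))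
             \<le> norm (f u - f x - (u - x) *\<^sub>R f' x) + norm (f v - f x - (v - x) *\<^sub>R f' x)"
            by (rule norm_triangle_ineq4)
          moreover have "\<eta> * \<bar>u - x\<bar> + \<eta> * \<bar>v - x\<bar> = \<eta> * (v - u)" using m by (simp add: algebra_simps)
          ultimately have "norm ((f u - f x - (u - x) *\<^sub>R f' x) - (f v - f x - (v - x) *\<^sub>R f' x)) \<le> \<eta> * (v - u)"
            by linarith
          moreover have "measure lborel k *\<^sub>R f' x - ?\<Delta> k = (f u - f x - (u - x) *\<^sub>R f' x) - (f v - f x - (v - x) *\<^sub>R f' x)"
            unfolding K(7) u_def[symmetric] v_def[symmetric] by (simp add: algebra_simps)
          ultimately show "norm (measure lborel k *\<^sub>R f' x - ?\<Delta> k) \<le> \<eta> * (Sup k - Inf k)"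
            unfolding u_def[symmetric] v_def[symmetric] by (simp only:)
        qed
        also have "\<dots> \<le> (\<Sum>(x,k)\<in>p. \<eta> * (Sup k - Inf k))"
          using fin K(1) \<eta>(1) by (intro sum_mono2) auto
        also have "\<dots> = \<eta> * (\<Sum>(x,k)\<in>p. Sup k - Inf k)"
          by (simp add: sum_distrib_left case_prod_beta)
        also have "\<dots> = \<eta> * (b - a)"
          using additive_tagged_division_1[OF ab p, of "\<lambda>x. x"] by simp
        finally show ?thesis .
      qed
      have "(\<Sum>(x,k)\<in>p. measure lborel k *\<^sub>R f' x) - (f b - f a) = (\<Sum>(x,k)\<in>p. measure lborel k *\<^sub>R f' x - ?\<Delta> k)"
        using additive_tagged_division_1[OF ab p, of f] by (simp add: sum_subtractf case_prod_beta)
      also have "norm \<dots> \<le> (\<Sum>(x,k)\<in>p. norm (measure lborel k *\<^sub>R f' x - ?\<Delta> k))"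
        by (rule order_trans[OF norm_sum]) (simp add: case_prod_beta)
      also have "\<dots> = (\<Sum>(x,k)\<in>P. norm (measure lborel k *\<^sub>R f' x - ?\<Delta> k)) + (\<Sum>(x,k)\<in>p - P. norm (measure lborel k *\<^sub>R f' x - ?\<Delta> k))"
        using sum.subset_diff[OF P(1) fin] by (simp add: add.commute)
      also have "\<dots> < e" using bad good \<eta>(2) by linarith
      finally show "norm ((\<Sum>(x,k)\<in>p. measure lborel k *\<^sub>R f' x) - (f b - f a)) < e" .
    qed
  qed
  then show ?thesis
    by (rule has_integral_spike[OF N, rotated]) (auto simp: f'_def)
qed

section \<open>Locally absolutely continuous functions\<close>

lemma AC_locD: "f \<in> AC_loc \<Longrightarrow> -1 < a \<Longrightarrow> a \<le> b \<Longrightarrow> b < 1 \<Longrightarrow> abs_cont_on a b f"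
  unfolding AC_loc_def by blast

lemma AC_loc_continuous_on:
  assumes "f \<in> AC_loc"
  shows "continuous_on II f"
proof (rule continuous_at_imp_continuous_on, rule ballI)
  fix x assume "x \<in> II"
  then obtain a b where ab: "-1 < a" "a < x" "x < b" "b < 1"
    unfolding II_def using dense by (metis greaterThanLessThan_iff)
  then have "continuous_on {a..b} f" using abs_cont_on_continuous[OF AC_locD[OF assms]] by simp
  then show "isCont f x" using ab by (intro continuous_on_interior) auto
qed

lemma AC_loc_differentiable_ae:
  assumes "f \<in> AC_loc"
  shows "negligible {x \<in> II. \<not> f differentiable (at x)}"
proof -
  define E where "E p q = {x \<in> {p<..<q}. \<not> f differentiable (at x)}" for p q
  let ?I = "(\<rat> \<times> \<rat>) \<inter> {(p, q). -1 < p \<and> p \<le> q \<and> q < 1}"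
  have "negligible (\<Union>(p,q)\<in>?I. E p q)"
  proof (rule negligible_countable_Union)
    have "countable ?I" using countable_rat by (intro countable_Int1 countable_SIGMA) auto
    then show "countable ((\<lambda>(p, q). E p q) ` ?I)" by (rule countable_image)
    fix S assume "S \<in> (\<lambda>(p, q). E p q) ` ?I"
    then obtain p q where "S = E p q" "-1 < p" "p \<le> q" "q < 1" by auto
    then show "negligible S"
      using abs_cont_on_differentiable_ae[OF AC_locD[OF assms]] unfolding E_def by simp
  qed
  then show ?thesis
  proof (rule negligible_subset)
    show "{x \<in> II. \<not> f differentiable (at x)} \<subseteq> (\<Union>(p,q)\<in>?I. E p q)"
    proof
      fix x assume x: "x \<in> {x \<in> II. \<not> f differentiable (at x)}"
      obtain p where p: "p \<in> \<rat>" "-1 < p" "p < x"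
        using Rats_dense_in_real[of "-1" x] x unfolding II_def by auto
      obtain q where q: "q \<in> \<rat>" "x < q" "q < 1"
        using Rats_dense_in_real[of x 1] x unfolding II_def by auto
      have "(p, q) \<in> ?I" "x \<in> E p q" using x p q unfolding E_def by auto
      then show "x \<in> (\<Union>(p,q)\<in>?I. E p q)" by blast
    qed
  qed
qed

lemma AC_loc_mult:
  assumes f: "f \<in> AC_loc" and g: "g \<in> AC_loc"
  shows "(\<lambda>x. f x * g x) \<in> AC_loc"
  unfolding AC_loc_def mem_Collect_eq
proof (intro allI impI)
  fix a b :: real assume ab: "-1 < a \<and> a \<le> b \<and> b < 1"
  have F: "abs_cont_on a b f" and G: "abs_cont_on a b g" using f g ab by (auto intro: AC_locD)
  have "bounded (f ` {a..b})" "bounded (g ` {a..b})"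
    using F G by (auto intro!: compact_imp_bounded compact_continuous_image abs_cont_on_continuous)
  then obtain M N where M: "\<And>x. x \<in> {a..b} \<Longrightarrow> norm (f x) \<le> M" and N: "\<And>x. x \<in> {a..b} \<Longrightarrow> norm (g x) \<le> N"
    unfolding bounded_iff by blast
  define R where "R = \<bar>M\<bar> + \<bar>N\<bar> + 1"
  have R: "norm (f x) \<le> R" "norm (g x) \<le> R" if "x \<in> {a..b}" for x
    using M[OF that] N[OF that] unfolding R_def by auto
  have R0: "0 < R" unfolding R_def by auto
  show "abs_cont_on a b (\<lambda>x. f x * g x)"
    unfolding abs_cont_on_def
  proof (intro allI impI)
    fix \<epsilon> :: real assume "0 < \<epsilon>"
    then have e: "0 < \<epsilon> / (2 * R)" using R0 by simp
    obtain \<delta> where \<delta>: "0 < \<delta>" "\<And>d. d division_of \<Union>d \<Longrightarrow> \<Union>d \<subseteq> {a..b} \<Longrightarrow> (\<Sum>k\<in>d. Sup k - Inf k) < \<delta>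
        \<Longrightarrow> (\<Sum>k\<in>d. norm (f (Sup k) - f (Inf k))) < \<epsilon> / (2 * R)"
      using abs_cont_onD[OF F e] by blast
    obtain \<delta>' where \<delta>': "0 < \<delta>'" "\<And>d. d division_of \<Union>d \<Longrightarrow> \<Union>d \<subseteq> {a..b} \<Longrightarrow> (\<Sum>k\<in>d. Sup k - Inf k) < \<delta>'
        \<Longrightarrow> (\<Sum>k\<in>d. norm (g (Sup k) - g (Inf k))) < \<epsilon> / (2 * R)"
      using abs_cont_onD[OF G e] by blast
    show "\<exists>\<delta>>0. \<forall>d. d division_of \<Union>d \<and> \<Union>d \<subseteq> {a..b} \<and> (\<Sum>k\<in>d. Sup k - Inf k) < \<delta>
       \<longrightarrow> (\<Sum>k\<in>d. norm (f (Sup k) * g (Sup k) - f (Inf k) * g (Inf k))) < \<epsilon>"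
    proof (intro exI[of _ "min \<delta> \<delta>'"] conjI allI impI; (elim conjE)?)
      show "0 < min \<delta> \<delta>'" using \<delta>(1) \<delta>'(1) by simp
      fix d assume d: "d division_of \<Union>d" "\<Union>d \<subseteq> {a..b}" "(\<Sum>k\<in>d. Sup k - Inf k) < min \<delta> \<delta>'"
      have "(\<Sum>k\<in>d. norm (f (Sup k) * g (Sup k) - f (Inf k) * g (Inf k)))
        \<le> (\<Sum>k\<in>d. R * norm (f (Sup k) - f (Inf k)) + R * norm (g (Sup k) - g (Inf k)))"
      proof (rule sum_mono)
        fix k assume "k \<in> d"
        then have k: "Inf k \<in> {a..b}" "Sup k \<in> {a..b}" using division_interval(3,4)[OF d(1)] d(2) by blast+
        have "f (Sup k) * g (Sup k) - f (Inf k) * g (Inf k) =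
           (f (Sup k) - f (Inf k)) * g (Sup k) + f (Inf k) * (g (Sup k) - g (Inf k))"
          by (simp add: algebra_simps)
        also have "norm \<dots> \<le> norm (f (Sup k) - f (Inf k)) * norm (g (Sup k)) + norm (f (Inf k)) * norm (g (Sup k) - g (Inf k))"
          by (rule order_trans[OF norm_triangle_ineq]) (simp add: norm_mult)
        also have "\<dots> \<le> norm (f (Sup k) - f (Inf k)) * R + R * norm (g (Sup k) - g (Inf k))"
          using R(1)[OF k(1)] R(2)[OF k(2)] R0 by (intro add_mono mult_mono) auto
        finally show "norm (f (Sup k) * g (Sup k) - f (Inf k) * g (Inf k))
          \<le> R * norm (f (Sup k) - f (Inf k)) + R * norm (g (Sup k) - g (Inf k))"
          by (simp add: mult.commute)
      qed
      also have "\<dots> = R * (\<Sum>k\<in>d. norm (f (Sup k) - f (Inf k))) + R * (\<Sum>k\<in>d. norm (g (Sup k) - g (Inf k)))"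
        by (simp add: sum.distrib sum_distrib_left)
      also have "\<dots> < R * (\<epsilon> / (2 * R)) + R * (\<epsilon> / (2 * R))"
        using R0 d \<delta>(2) \<delta>'(2) by (intro add_strict_mono mult_strict_left_mono) auto
      also have "\<dots> = \<epsilon>" using R0 by simp
      finally show "(\<Sum>k\<in>d. norm (f (Sup k) * g (Sup k) - f (Inf k) * g (Inf k))) < \<epsilon>" .
    qed
  qed
qed

lemma AC_loc_add:
  assumes f: "f \<in> AC_loc" and g: "g \<in> AC_loc"
  shows "(\<lambda>x. f x + g x) \<in> AC_loc"
  unfolding AC_loc_def mem_Collect_eq
proof (intro allI impI)
  fix a b :: real assume ab: "-1 < a \<and> a \<le> b \<and> b < 1"
  have F: "abs_cont_on a b f" and G: "abs_cont_on a b g" using f g ab by (auto intro: AC_locD)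
  show "abs_cont_on a b (\<lambda>x. f x + g x)"
    unfolding abs_cont_on_def
  proof (intro allI impI)
    fix \<epsilon> :: real assume "0 < \<epsilon>"
    then have e: "0 < \<epsilon> / 2" by simp
    obtain \<delta> where \<delta>: "0 < \<delta>" "\<And>d. d division_of \<Union>d \<Longrightarrow> \<Union>d \<subseteq> {a..b} \<Longrightarrow> (\<Sum>k\<in>d. Sup k - Inf k) < \<delta>
        \<Longrightarrow> (\<Sum>k\<in>d. norm (f (Sup k) - f (Inf k))) < \<epsilon> / 2"
      using abs_cont_onD[OF F e] by blast
    obtain \<delta>' where \<delta>': "0 < \<delta>'" "\<And>d. d division_of \<Union>d \<Longrightarrow> \<Union>d \<subseteq> {a..b} \<Longrightarrow> (\<Sum>k\<in>d. Sup k - Inf k) < \<delta>'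
        \<Longrightarrow> (\<Sum>k\<in>d. norm (g (Sup k) - g (Inf k))) < \<epsilon> / 2"
      using abs_cont_onD[OF G e] by blast
    show "\<exists>\<delta>>0. \<forall>d. d division_of \<Union>d \<and> \<Union>d \<subseteq> {a..b} \<and> (\<Sum>k\<in>d. Sup k - Inf k) < \<delta>
       \<longrightarrow> (\<Sum>k\<in>d. norm (f (Sup k) + g (Sup k) - (f (Inf k) + g (Inf k)))) < \<epsilon>"
    proof (intro exI[of _ "min \<delta> \<delta>'"] conjI allI impI; (elim conjE)?)
      show "0 < min \<delta> \<delta>'" using \<delta>(1) \<delta>'(1) by simp
      fix d assume d: "d division_of \<Union>d" "\<Union>d \<subseteq> {a..b}" "(\<Sum>k\<in>d. Sup k - Inf k) < min \<delta> \<delta>'"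
      have "(\<Sum>k\<in>d. norm (f (Sup k) + g (Sup k) - (f (Inf k) + g (Inf k))))
        \<le> (\<Sum>k\<in>d. norm (f (Sup k) - f (Inf k)) + norm (g (Sup k) - g (Inf k)))"
        by (intro sum_mono norm_diff_triangle_ineq)
      also have "\<dots> = (\<Sum>k\<in>d. norm (f (Sup k) - f (Inf k))) + (\<Sum>k\<in>d. norm (g (Sup k) - g (Inf k)))"
        by (rule sum.distrib)
      also have "\<dots> < \<epsilon> / 2 + \<epsilon> / 2"
        using d \<delta>(2) \<delta>'(2) by (intro add_strict_mono) auto
      finally show "(\<Sum>k\<in>d. norm (f (Sup k) + g (Sup k) - (f (Inf k) + g (Inf k)))) < \<epsilon>" by simp
    qed
  qed
qed

lemma AC_loc_cnj: "f \<in> AC_loc \<Longrightarrow> (\<lambda>x. cnj (f x)) \<in> AC_loc"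
  unfolding AC_loc_def abs_cont_on_def by (simp flip: complex_cnj_diff)

text \<open>A continuous derivative is bounded on compact subintervals, so the function is Lipschitz
  there. This makes the polynomial and power weights multipliers of \<open>AC_loc\<close>.\<close>

lemma AC_loc_C1:
  assumes deriv: "\<And>x. x \<in> II \<Longrightarrow> (f has_vector_derivative f' x) (at x)" and cont: "continuous_on II f'"
  shows "f \<in> AC_loc"
  unfolding AC_loc_def mem_Collect_eq
proof (intro allI impI)
  fix a b :: real assume ab: "-1 < a \<and> a \<le> b \<and> b < 1"
  then have sub: "{a..b} \<subseteq> II" unfolding II_def by auto
  then have "compact (f' ` {a..b})"
    using cont by (intro compact_continuous_image continuous_on_subset[OF cont]) auto
  then have "bounded (f' ` {a..b})" by (rule compact_imp_bounded)
  then obtain M where "\<forall>y \<in> f' ` {a..b}. norm y \<le> M" unfolding bounded_iff ..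
  then have M: "norm (f' x) \<le> M" if "x \<in> {a..b}" for x using that by simp
  have lip: "norm (f y - f x) \<le> (\<bar>M\<bar> + 1) * (y - x)" if "x \<in> {a..b}" "y \<in> {a..b}" "x \<le> y" for x y
  proof -
    have "x = y \<or> x < y" using that by auto
    then show ?thesis
    proof
      assume "x < y"
      have sub': "{x..y} \<subseteq> II" using that sub by auto
      have "norm (f y - f x) \<le> (\<bar>M\<bar> + 1) * y - (\<bar>M\<bar> + 1) * x"
      proof (rule differentiable_bound_general[OF \<open>x < y\<close>])
        show "continuous_on {x..y} f"
          using deriv sub' has_vector_derivative_continuous
          by (intro continuous_at_imp_continuous_on) blast
        show "continuous_on {x..y} (\<lambda>t. (\<bar>M\<bar> + 1) * t)" by (intro continuous_intros)
        fix t assume t: "x < t" "t < y"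
        then show "(f has_vector_derivative f' t) (at t)" using sub' by (intro deriv) auto
        show "((\<lambda>t. (\<bar>M\<bar> + 1) * t) has_vector_derivative \<bar>M\<bar> + 1) (at t)"
          by (auto intro!: derivative_eq_intros simp flip: has_real_derivative_iff_has_vector_derivative)
        show "norm (f' t) \<le> \<bar>M\<bar> + 1" using M[of t] t that by auto
      qed
      then show ?thesis by (simp add: algebra_simps)
    qed simp
  qed
  show "abs_cont_on a b f"
    unfolding abs_cont_on_def
  proof (intro allI impI)
    fix \<epsilon> :: real assume e: "0 < \<epsilon>"
    show "\<exists>\<delta>>0. \<forall>d. d division_of \<Union>d \<and> \<Union>d \<subseteq> {a..b} \<and> (\<Sum>k\<in>d. Sup k - Inf k) < \<delta>
       \<longrightarrow> (\<Sum>k\<in>d. norm (f (Sup k) - f (Inf k))) < \<epsilon>"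
    proof (intro exI[of _ "\<epsilon> / (\<bar>M\<bar> + 1)"] conjI allI impI; (elim conjE)?)
      show "0 < \<epsilon> / (\<bar>M\<bar> + 1)" using e by simp
      fix d assume d: "d division_of \<Union>d" "\<Union>d \<subseteq> {a..b}" "(\<Sum>k\<in>d. Sup k - Inf k) < \<epsilon> / (\<bar>M\<bar> + 1)"
      have "(\<Sum>k\<in>d. norm (f (Sup k) - f (Inf k))) \<le> (\<Sum>k\<in>d. (\<bar>M\<bar> + 1) * (Sup k - Inf k))"
      proof (rule sum_mono)
        fix k assume k: "k \<in> d"
        show "norm (f (Sup k) - f (Inf k)) \<le> (\<bar>M\<bar> + 1) * (Sup k - Inf k)"
          using division_interval(2,3,4)[OF d(1) k] d(2) by (intro lip) auto
      qed
      also have "\<dots> = (\<bar>M\<bar> + 1) * (\<Sum>k\<in>d. Sup k - Inf k)" by (simp add: sum_distrib_left)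
      also have "\<dots> < (\<bar>M\<bar> + 1) * (\<epsilon> / (\<bar>M\<bar> + 1))"
        using d(3) by (intro mult_strict_left_mono) auto
      also have "\<dots> = \<epsilon>" by (simp add: field_simps)
      finally show "(\<Sum>k\<in>d. norm (f (Sup k) - f (Inf k))) < \<epsilon>" .
    qed
  qed
qed

lemma AC_loc_of_real:
  assumes "\<And>x. x \<in> II \<Longrightarrow> (\<phi> has_real_derivative \<phi>' x) (at x)" "continuous_on II \<phi>'"
  shows "(\<lambda>x. complex_of_real (\<phi> x)) \<in> AC_loc"
proof (rule AC_loc_C1)
  show "((\<lambda>x. complex_of_real (\<phi> x)) has_vector_derivative of_real (\<phi>' x)) (at x)" if "x \<in> II" for x
    using assms(1)[OF that] by (rule has_vector_derivative_of_real)
  show "continuous_on II (\<lambda>x. complex_of_real (\<phi>' x))"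
    using assms(2) by (intro continuous_intros)
qed

lemma AC_loc_scaleR:
  assumes "\<And>x. x \<in> II \<Longrightarrow> (\<phi> has_real_derivative \<phi>' x) (at x)" "continuous_on II \<phi>'" "f \<in> AC_loc"
  shows "(\<lambda>x. \<phi> x *\<^sub>R f x) \<in> AC_loc"
  using AC_loc_mult[OF AC_loc_of_real[OF assms(1,2)] assms(3)] by (simp add: scaleR_conv_of_real)

text \<open>\<open>D\<close> acts on total functions, while formulas for derivatives are known only
  on \<open>II\<close>. Since \<open>II\<close> is open, such a formula may still be substituted
  under an outer \<open>D\<close>.\<close>

lemma D_cong:
  assumes "\<And>t. t \<in> II \<Longrightarrow> g t = h t" "x \<in> II"
  shows "D g x = D h x"
proof -
  have "open II" unfolding II_def by simp
  have "(g has_vector_derivative y) (at x) \<longleftrightarrow> (h has_vector_derivative y) (at x)" for y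
  proof
    assume "(g has_vector_derivative y) (at x)"
    then show "(h has_vector_derivative y) (at x)"
      by (rule has_vector_derivative_transform_within_open[OF _ \<open>open II\<close> assms(2)]) (rule assms(1))
  next
    assume "(h has_vector_derivative y) (at x)"
    then show "(g has_vector_derivative y) (at x)"
      by (rule has_vector_derivative_transform_within_open[OF _ \<open>open II\<close> assms(2)]) (rule assms(1)[symmetric])
  qed
  then show ?thesis unfolding D_def vector_derivative_def by simp
qed

lemma D_eq: "(f has_vector_derivative y) (at x) \<Longrightarrow> D f x = y"
  unfolding D_def by (rule vector_derivative_at)

lemma D_works: "f differentiable (at x) \<Longrightarrow> (f has_vector_derivative D f x) (at x)"
  unfolding D_def by (simp add: vector_derivative_works)

section \<open>Square integrable functions\<close>

lemma II_facts: "II \<in> sets lebesgue" "space (lebesgue_on II) = II" "open II" "II \<in> lmeasurable"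
  unfolding II_def by auto

lemma L2_dominated:
  assumes "w \<in> L2" "g \<in> borel_measurable (lebesgue_on II)" "\<And>x. x \<in> II \<Longrightarrow> norm (g x) \<le> norm (w x)"
  shows "g \<in> L2"
  unfolding L2_def mem_Collect_eq
proof
  show "integrable (lebesgue_on II) (\<lambda>x. (norm (g x))\<^sup>2)"
  proof (rule Bochner_Integration.integrable_bound)
    show "integrable (lebesgue_on II) (\<lambda>x. (norm (w x))\<^sup>2)" using assms(1) unfolding L2_def by simp
    show "(\<lambda>x. (norm (g x))\<^sup>2) \<in> borel_measurable (lebesgue_on II)" using assms(2) by measurable
    show "AE x in lebesgue_on II. norm ((norm (g x))\<^sup>2) \<le> norm ((norm (w x))\<^sup>2)"
      using assms(3) by (intro AE_I2) (simp add: II_facts power_mono)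
  qed
qed fact

lemma L2_add:
  assumes "f \<in> L2" "g \<in> L2"
  shows "(\<lambda>x. f x + g x) \<in> L2"
  unfolding L2_def mem_Collect_eq
proof
  have m: "f \<in> borel_measurable (lebesgue_on II)" "g \<in> borel_measurable (lebesgue_on II)"
    and i: "integrable (lebesgue_on II) (\<lambda>x. (norm (f x))\<^sup>2)" "integrable (lebesgue_on II) (\<lambda>x. (norm (g x))\<^sup>2)"
    using assms unfolding L2_def by auto
  show mm: "(\<lambda>x. f x + g x) \<in> borel_measurable (lebesgue_on II)" using m by measurable
  show "integrable (lebesgue_on II) (\<lambda>x. (norm (f x + g x))\<^sup>2)"
  proof (rule Bochner_Integration.integrable_bound)
    show "integrable (lebesgue_on II) (\<lambda>x. 2 * (norm (f x))\<^sup>2 + 2 * (norm (g x))\<^sup>2)" using i by simp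
    show "(\<lambda>x. (norm (f x + g x))\<^sup>2) \<in> borel_measurable (lebesgue_on II)" using mm by measurable
    have "(norm (f x + g x))\<^sup>2 \<le> 2 * (norm (f x))\<^sup>2 + 2 * (norm (g x))\<^sup>2" for x
    proof -
      have "(norm (f x + g x))\<^sup>2 \<le> (norm (f x) + norm (g x))\<^sup>2" by (intro power_mono norm_triangle_ineq) auto
      also have "\<dots> \<le> 2 * (norm (f x))\<^sup>2 + 2 * (norm (g x))\<^sup>2"
        using zero_le_power2[of "norm (f x) - norm (g x)"] by (simp add: power2_eq_square algebra_simps)
      finally show ?thesis .
    qed
    then show "AE x in lebesgue_on II. norm ((norm (f x + g x))\<^sup>2) \<le> norm (2 * (norm (f x))\<^sup>2 + 2 * (norm (g x))\<^sup>2)"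
      by (intro AE_I2) simp
  qed
qed

lemma L2_scaleR:
  assumes "w \<in> L2" "continuous_on II \<phi>" "\<And>x. x \<in> II \<Longrightarrow> \<bar>\<phi> x\<bar> \<le> M"
  shows "(\<lambda>x. \<phi> x *\<^sub>R w x) \<in> L2"
  unfolding L2_def mem_Collect_eq
proof
  have m: "w \<in> borel_measurable (lebesgue_on II)" "\<phi> \<in> borel_measurable (lebesgue_on II)"
    using assms(1,2) unfolding L2_def by (auto intro: continuous_imp_measurable_on_sets_lebesgue simp: II_facts)
  show mm: "(\<lambda>x. \<phi> x *\<^sub>R w x) \<in> borel_measurable (lebesgue_on II)" using m by measurable
  show "integrable (lebesgue_on II) (\<lambda>x. (norm (\<phi> x *\<^sub>R w x))\<^sup>2)"
  proof (rule Bochner_Integration.integrable_bound)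
    show "integrable (lebesgue_on II) (\<lambda>x. M\<^sup>2 * (norm (w x))\<^sup>2)" using assms(1) unfolding L2_def by simp
    show "(\<lambda>x. (norm (\<phi> x *\<^sub>R w x))\<^sup>2) \<in> borel_measurable (lebesgue_on II)" using mm by measurable
    show "AE x in lebesgue_on II. norm ((norm (\<phi> x *\<^sub>R w x))\<^sup>2) \<le> norm (M\<^sup>2 * (norm (w x))\<^sup>2)"
    proof (rule AE_I2)
      fix x assume "x \<in> space (lebesgue_on II)"
      then have "(\<bar>\<phi> x\<bar>)\<^sup>2 \<le> M\<^sup>2" using assms(3) by (intro power_mono) (auto simp: II_facts)
      then show "norm ((norm (\<phi> x *\<^sub>R w x))\<^sup>2) \<le> norm (M\<^sup>2 * (norm (w x))\<^sup>2)"
        by (simp add: power_mult_distrib mult_right_mono)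
    qed
  qed
qed

lemma L2_continuous_bounded:
  assumes "continuous_on II f" "\<And>x. x \<in> II \<Longrightarrow> norm (f x) \<le> M"
  shows "f \<in> L2"
proof (rule L2_dominated[where w="\<lambda>_. of_real M"])
  have "finite_measure (lebesgue_on II)" using II_facts(4) by (rule finite_measure_lebesgue_on)
  then show "(\<lambda>_. of_real M) \<in> L2" unfolding L2_def by (simp add: finite_measure.integrable_const)
  show "f \<in> borel_measurable (lebesgue_on II)"
    using assms(1) II_facts(1) by (rule continuous_imp_measurable_on_sets_lebesgue)
  show "norm (f x) \<le> norm (complex_of_real M)" if "x \<in> II" for x
    using assms(2)[OF that] by simp
qed

text \<open>Needed because the identities involving a fourth derivative hold only where the third
  derivative is differentiable.\<close>

lemma L2_spike:
  assumes "f \<in> L2" "negligible N" "\<And>x. x \<in> II - N \<Longrightarrow> g x = f x"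
  shows "g \<in> L2"
proof -
  have f: "f \<in> borel_measurable (lebesgue_on II)" "integrable (lebesgue_on II) (\<lambda>x. (norm (f x))\<^sup>2)"
    using assms(1) unfolding L2_def by auto
  have ae: "AE x in lebesgue. x \<notin> N"
    using assms(2) by (intro AE_not_in) (simp add: negligible_iff_null_sets)
  \<comment> \<open>Measurability is transferred on the whole line, where completeness of Lebesgue
    measure allows changes on null sets.\<close>
  have "(\<lambda>x. if x \<in> II then f x else 0) \<in> borel_measurable lebesgue"
    using f(1) II_facts(1) by (simp add: borel_measurable_if)
  moreover have "AE x in lebesgue. (if x \<in> II then f x else 0) = (if x \<in> II then g x else 0)"
    using ae by eventually_elim (use assms(3) in auto)
  ultimately have "(\<lambda>x. if x \<in> II then g x else 0) \<in> borel_measurable lebesgue"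
    by (rule borel_measurable_AE)
  then have g: "g \<in> borel_measurable (lebesgue_on II)"
    using II_facts(1) by (simp add: borel_measurable_if)
  have "AE x in lebesgue_on II. (norm (f x))\<^sup>2 = (norm (g x))\<^sup>2"
  proof -
    have "AE x in lebesgue. x \<in> II \<longrightarrow> (norm (f x))\<^sup>2 = (norm (g x))\<^sup>2"
      using ae by eventually_elim (use assms(3) in auto)
    then show ?thesis using II_facts(1) by (subst AE_restrict_space_iff) auto
  qed
  then have "integrable (lebesgue_on II) (\<lambda>x. (norm (g x))\<^sup>2)"
    using f(2) g by (intro integrable_cong_AE_imp[OF f(2)]) auto
  with g show ?thesis unfolding L2_def by simp
qed

section \<open>Growth and decay estimates\<close>

lemma weight_pos: "x \<in> II \<Longrightarrow> 0 < 1 - x\<^sup>2"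
  unfolding II_def by (auto simp: abs_square_less_1[of x] power2_eq_square[symmetric] abs_less_iff)

lemma weight_lower:
  assumes "x \<in> II"
  shows "0 \<le> x \<Longrightarrow> 1 - x \<le> 1 - x\<^sup>2" "x \<le> 0 \<Longrightarrow> 1 + x \<le> 1 - x\<^sup>2"
proof -
  have x: "-1 < x" "x < 1" using assms unfolding II_def by auto
  show "1 - x \<le> 1 - x\<^sup>2" if "0 \<le> x"
    using mult_left_le[of x x] x that by (simp add: power2_eq_square)
  show "1 + x \<le> 1 - x\<^sup>2" if "x \<le> 0"
    using mult_left_le[of "-x" "-x"] x that by (simp add: power2_eq_square)
qed

lemma L2_subinterval:
  assumes "w \<in> L2" "{x..y} \<subseteq> II"
  shows "(\<lambda>t. (norm (w t))\<^sup>2) integrable_on {x..y}"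
    and "integral {x..y} (\<lambda>t. (norm (w t))\<^sup>2) \<le> integral II (\<lambda>t. (norm (w t))\<^sup>2)"
proof -
  have i: "(\<lambda>t. (norm (w t))\<^sup>2) integrable_on II"
    using assms(1) II_facts(1) unfolding L2_def by (intro integrable_on_lebesgue_on) auto
  show j: "(\<lambda>t. (norm (w t))\<^sup>2) integrable_on {x..y}"
    using integrable_on_subinterval[OF i, of x y] assms(2) by simp
  show "integral {x..y} (\<lambda>t. (norm (w t))\<^sup>2) \<le> integral II (\<lambda>t. (norm (w t))\<^sup>2)"
    by (rule integral_subset_le[OF assms(2) j i]) auto
qed

lemma L2_integral_nonneg: "w \<in> L2 \<Longrightarrow> 0 \<le> integral II (\<lambda>t. (norm (w t))\<^sup>2)"
  by (cases "(\<lambda>t. (norm (w t))\<^sup>2) integrable_on II")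
    (auto intro!: Henstock_Kurzweil_Integration.integral_nonneg simp: not_integrable_integral)

text \<open>The Cauchy--Schwarz inequality for \<open>v(y) - v(x)\<close>, obtained from the weighted inequality between
  arithmetic and geometric mean by optimising the weight; this way \<open>D v\<close> need not be
  absolutely integrable.\<close>

lemma AC_loc_increment_bound:
  assumes v: "v \<in> AC_loc" and w: "w \<in> L2" and N: "negligible N" and xy: "-1 < x" "x \<le> y" "y < 1"
    and bound: "\<And>t. t \<in> {x..y} - N \<Longrightarrow> norm (D v t) \<le> \<rho> t * norm (w t)"
    and \<rho>: "(\<lambda>t. (\<rho> t)\<^sup>2) integrable_on {x..y}" "integral {x..y} (\<lambda>t. (\<rho> t)\<^sup>2) \<le> R" "0 < R"
  shows "(norm (v y - v x))\<^sup>2 \<le> R * integral II (\<lambda>t. (norm (w t))\<^sup>2)"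
proof -
  define W where "W = integral II (\<lambda>t. (norm (w t))\<^sup>2)"
  define c where "c = norm (v y - v x)"
  have sub: "{x..y} \<subseteq> II" using xy unfolding II_def by auto
  note wi = L2_subinterval[OF w sub]
  have 1: "c \<le> (s * W + R / s) / 2" if s: "0 < s" for s
  proof -
    define g where "g t = (if t \<in> N then 0 else D v t)" for t
    have "(D v has_integral v y - v x) {x..y}"
      using abs_cont_on_has_integral[OF AC_locD[OF v xy] xy(2)] .
    then have g: "(g has_integral v y - v x) {x..y}"
      by (rule has_integral_spike[OF N, rotated]) (auto simp: g_def)
    have i: "(\<lambda>t. (s * (norm (w t))\<^sup>2 + (\<rho> t)\<^sup>2 / s) / 2) integrable_on {x..y}"
      using wi(1) \<rho>(1) by (intro integrable_add integrable_on_mult_right integrable_on_divide)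
    have "norm (integral {x..y} g) \<le> integral {x..y} (\<lambda>t. (s * (norm (w t))\<^sup>2 + (\<rho> t)\<^sup>2 / s) / 2)"
    proof (rule Henstock_Kurzweil_Integration.integral_norm_bound_integral[OF _ i])
      show "g integrable_on {x..y}" using g by (rule has_integral_integrable)
      fix t assume t: "t \<in> {x..y}"
      have "0 \<le> (s * norm (w t) - \<rho> t)\<^sup>2 / s" using s by simp
      also have "\<dots> = (s * (norm (w t))\<^sup>2 + (\<rho> t)\<^sup>2 / s) - 2 * (\<rho> t * norm (w t))"
        using s by (simp add: power2_eq_square field_simps)
      finally have am: "\<rho> t * norm (w t) \<le> (s * (norm (w t))\<^sup>2 + (\<rho> t)\<^sup>2 / s) / 2" by simp
      have "0 \<le> (s * (norm (w t))\<^sup>2 + (\<rho> t)\<^sup>2 / s) / 2" using s by simp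
      with am bound[of t] t show "norm (g t) \<le> (s * (norm (w t))\<^sup>2 + (\<rho> t)\<^sup>2 / s) / 2"
        unfolding g_def by (cases "t \<in> N") auto
    qed
    also have "\<dots> = (s * integral {x..y} (\<lambda>t. (norm (w t))\<^sup>2) + integral {x..y} (\<lambda>t. (\<rho> t)\<^sup>2) / s) / 2"
      by (intro integral_unique has_integral_divide has_integral_add has_integral_mult_right integrable_integral wi(1) \<rho>(1))
    also have "\<dots> \<le> (s * W + R / s) / 2"
      using s wi(2) \<rho>(2) unfolding W_def by (intro divide_right_mono add_mono mult_left_mono) auto
    finally show ?thesis using integral_unique[OF g] unfolding c_def by simp
  qed
  have "c\<^sup>2 \<le> R * W"
  proof (cases "c = 0")
    case True
    have "0 \<le> W" unfolding W_def using L2_integral_nonneg[OF w] .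
    then show ?thesis using True \<rho>(3) by simp
  next
    case False
    then have c: "0 < c" unfolding c_def by simp
    \<comment> \<open>The weight \<open>R / c\<close> turns the second term into \<open>c\<close>,
      half of which is absorbed on the left. The minimising weight, the square root of R / W, would
      need a separate case W = 0.\<close>
    have "c \<le> (R / c * W + R / (R / c)) / 2" using 1[of "R / c"] c \<rho>(3) by simp
    also have "R / (R / c) = c" using \<rho>(3) by simp
    finally have "c \<le> R * W / c" by simp
    then show ?thesis using c by (simp add: pos_le_divide_eq power2_eq_square)
  qed
  then show ?thesis unfolding c_def W_def .
qed

text \<open>Letting \<open>y\<close> tend to the end point turns a uniform bound for increments into
  one for \<open>v x\<close> itself, without extending \<open>v\<close> to the end point.\<close>

lemma norm_le_of_tendsto_0:
  fixes v :: "real \<Rightarrow> complex"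
  shows "(v \<longlongrightarrow> 0) (at_left 1) \<Longrightarrow> x < 1 \<Longrightarrow> (\<And>y. x < y \<Longrightarrow> y < 1 \<Longrightarrow> norm (v y - v x) \<le> K) \<Longrightarrow> norm (v x) \<le> K"
    and "(v \<longlongrightarrow> 0) (at_right (-1)) \<Longrightarrow> -1 < x \<Longrightarrow> (\<And>y. -1 < y \<Longrightarrow> y < x \<Longrightarrow> norm (v x - v y) \<le> K) \<Longrightarrow> norm (v x) \<le> K"
proof -
  have lim: "((\<lambda>y. norm (v y - v x)) \<longlongrightarrow> norm (v x)) F" if "(v \<longlongrightarrow> 0) F" for F
  proof -
    have "((\<lambda>y. norm (v y - v x)) \<longlongrightarrow> norm (0 - v x)) F" using that by (intro tendsto_intros)
    then show ?thesis by simp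
  qed
  show "norm (v x) \<le> K" if "(v \<longlongrightarrow> 0) (at_left 1)" "x < 1" "\<And>y. x < y \<Longrightarrow> y < 1 \<Longrightarrow> norm (v y - v x) \<le> K"
  proof (rule tendsto_upperbound[OF lim[OF that(1)]])
    show "\<forall>\<^sub>F y in at_left 1. norm (v y - v x) \<le> K"
      using eventually_at_left_real[OF that(2)] by eventually_elim (use that(3) in auto)
  qed simp
  show "norm (v x) \<le> K" if "(v \<longlongrightarrow> 0) (at_right (-1))" "-1 < x" "\<And>y. -1 < y \<Longrightarrow> y < x \<Longrightarrow> norm (v x - v y) \<le> K"
  proof (rule tendsto_upperbound[OF lim[OF that(1)]])
    show "\<forall>\<^sub>F y in at_right (-1). norm (v y - v x) \<le> K"
      using eventually_at_right_real[OF that(2)]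
      by eventually_elim (use that(3) in \<open>auto simp: norm_minus_commute\<close>)
  qed simp
qed

text \<open>Integrate \<open>D v\<close> from the nearer end point, where \<open>v\<close> vanishes,
  and use Cauchy-Schwarz. At distance q from that end the weight is at most \<open>2 * q\<close>, so
  the integral of its power \<open>2 * j\<close> is at most \<open>4 ^ j * q ^ (2 * j + 1)\<close>,
  and q is at most the weight at \<open>x\<close>.\<close>

lemma AC_loc_decay:
  fixes j :: nat
  assumes v: "v \<in> AC_loc" and w: "w \<in> L2" and N: "negligible N"
    and lim: "(v \<longlongrightarrow> 0) (at_left 1)" "(v \<longlongrightarrow> 0) (at_right (-1))"
    and bound: "\<And>t. t \<in> II - N \<Longrightarrow> norm (D v t) \<le> (1 - t\<^sup>2) ^ j * norm (w t)"
  obtains C where "\<And>x. x \<in> II \<Longrightarrow> (norm (v x))\<^sup>2 \<le> C * (1 - x\<^sup>2) ^ (2 * j + 1)"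
proof
  define W where "W = integral II (\<lambda>t. (norm (w t))\<^sup>2)"
  have W: "0 \<le> W" unfolding W_def using L2_integral_nonneg[OF w] .
  fix x assume x: "x \<in> II"
  have int: "(norm (v b - v a))\<^sup>2 \<le> 4 ^ j * q ^ (2 * j + 1) * W"
    if ab: "-1 < a" "a < b" "b < 1" and q: "b - a \<le> q" "\<And>t. t \<in> {a..b} \<Longrightarrow> 1 - t\<^sup>2 \<le> 2 * q" for a b q
    unfolding W_def
  proof (rule AC_loc_increment_bound[OF v w N ab(1) less_imp_le[OF ab(2)] ab(3)])
    have sub: "{a..b} \<subseteq> II" using ab unfolding II_def by auto
    show "norm (D v t) \<le> (1 - t\<^sup>2) ^ j * norm (w t)" if "t \<in> {a..b} - N" for t
      using bound sub that by auto
    show i: "(\<lambda>t. ((1 - t\<^sup>2) ^ j)\<^sup>2) integrable_on {a..b}"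
      by (intro integrable_continuous_real continuous_intros)
    have q0: "0 < q" using q(1) ab by simp
    have "integral {a..b} (\<lambda>t. ((1 - t\<^sup>2) ^ j)\<^sup>2) \<le> integral {a..b} (\<lambda>t. ((2 * q) ^ j)\<^sup>2)"
    proof (rule integral_le[OF i])
      fix t assume t: "t \<in> {a..b}"
      then have "0 < 1 - t\<^sup>2" using sub weight_pos by blast
      then show "((1 - t\<^sup>2) ^ j)\<^sup>2 \<le> ((2 * q) ^ j)\<^sup>2"
        using q(2)[OF t] by (intro power_mono) auto
    qed (rule integrable_const_ivl)
    also have "\<dots> = (b - a) * ((2 * q) ^ j)\<^sup>2" using ab by simp
    also have "\<dots> \<le> q * ((2 * q) ^ j)\<^sup>2" using q by (intro mult_right_mono) auto
    also have "\<dots> = 4 ^ j * q ^ (2 * j + 1)"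
    proof -
      have "((2 * q) ^ j)\<^sup>2 = ((2 * q)\<^sup>2) ^ j"
        by (simp only: power_mult[symmetric] mult.commute[of j])
      also have "\<dots> = 4 ^ j * q ^ (2 * j)" by (simp only: power_mult_distrib power_mult) simp
      finally show ?thesis by simp
    qed
    finally show "integral {a..b} (\<lambda>t. ((1 - t\<^sup>2) ^ j)\<^sup>2) \<le> 4 ^ j * q ^ (2 * j + 1)" .
    show "0 < 4 ^ j * q ^ (2 * j + 1)" using q0 by simp
  qed
  have fin: "(norm (v x))\<^sup>2 \<le> 4 ^ j * W * (1 - x\<^sup>2) ^ (2 * j + 1)"
    if q: "0 \<le> q" "q \<le> 1 - x\<^sup>2" "norm (v x) \<le> sqrt (4 ^ j * q ^ (2 * j + 1) * W)" for q
  proof -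
    have "(norm (v x))\<^sup>2 \<le> 4 ^ j * q ^ (2 * j + 1) * W"
      using power_mono[OF q(3), of 2] W q(1) by simp
    also have "\<dots> \<le> 4 ^ j * (1 - x\<^sup>2) ^ (2 * j + 1) * W"
      using q W by (intro mult_right_mono mult_left_mono power_mono) auto
    finally show ?thesis by (simp add: mult_ac)
  qed
  have x': "-1 < x" "x < 1" using x unfolding II_def by auto
  show "(norm (v x))\<^sup>2 \<le> 4 ^ j * W * (1 - x\<^sup>2) ^ (2 * j + 1)"
  proof (cases "0 \<le> x")
    case True
    have "norm (v x) \<le> sqrt (4 ^ j * (1 - x) ^ (2 * j + 1) * W)"
    proof (rule norm_le_of_tendsto_0(1)[OF lim(1) x'(2)], rule real_le_rsqrt, rule int)
      fix y t assume y: "x < y" "y < 1" and t: "t \<in> {x..y}"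
      have "1 - t\<^sup>2 = (1 - t) * (1 + t)" by (simp add: power2_eq_square algebra_simps)
      also have "\<dots> \<le> (1 - x) * 2" using t y x' by (intro mult_mono) auto
      finally show "1 - t\<^sup>2 \<le> 2 * (1 - x)" by simp
    qed (use x' in auto)
    then show ?thesis by (rule fin[rotated 2]) (use x' weight_lower(1)[OF x True] in auto)
  next
    case False
    have "norm (v x) \<le> sqrt (4 ^ j * (1 + x) ^ (2 * j + 1) * W)"
    proof (rule norm_le_of_tendsto_0(2)[OF lim(2) x'(1)], rule real_le_rsqrt, rule int)
      fix y t assume y: "-1 < y" "y < x" and t: "t \<in> {y..x}"
      have "1 - t\<^sup>2 = (1 + t) * (1 - t)" by (simp add: power2_eq_square algebra_simps)
      also have "\<dots> \<le> (1 + x) * 2" using t y x' by (intro mult_mono) auto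
      finally show "1 - t\<^sup>2 \<le> 2 * (1 + x)" by simp
    qed (use x' in auto)
    then show ?thesis by (rule fin[rotated 2]) (use x' weight_lower(2)[OF x] False in auto)
  qed
qed

text \<open>Integrate \<open>D v\<close> from 0 and use Cauchy-Schwarz: the integral of p^(-4) grows
  at most like p^(-3).\<close>

lemma AC_loc_growth:
  assumes v: "v \<in> AC_loc" and w: "w \<in> L2" and N: "negligible N"
    and bound: "\<And>t. t \<in> II - N \<Longrightarrow> (1 - t\<^sup>2)\<^sup>2 * norm (D v t) \<le> norm (w t)"
  obtains C where "\<And>x. x \<in> II \<Longrightarrow> (1 - x\<^sup>2) ^ 3 * (norm (v x))\<^sup>2 \<le> C"
proof
  define W where "W = integral II (\<lambda>t. (norm (w t))\<^sup>2)"
  have W: "0 \<le> W" unfolding W_def using L2_integral_nonneg[OF w] .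
  \<comment> \<open>This replaces an exact primitive of p^(-4): its derivative (1 + 5 t^2) / p^4
    dominates p^(-4), and its increment from 0 is at most p^(-3) in absolute value.\<close>
  define \<Phi> where "\<Phi> t = t / (1 - t\<^sup>2) ^ 3" for t :: real
  have int: "(norm (v b - v a))\<^sup>2 \<le> R * W"
    if ab: "-1 < a" "a \<le> b" "b < 1" "\<Phi> b - \<Phi> a \<le> R" "0 < R" for a b R
    unfolding W_def
  proof (rule AC_loc_increment_bound[OF v w N ab(1-3)])
    have sub: "{a..b} \<subseteq> II" using ab unfolding II_def by auto
    then have pos: "0 < 1 - t\<^sup>2" if "t \<in> {a..b}" for t using weight_pos that by blast
    show "norm (D v t) \<le> 1 / (1 - t\<^sup>2)\<^sup>2 * norm (w t)" if "t \<in> {a..b} - N" for t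
      using bound[of t] sub that pos[of t] by (auto simp: field_simps)
    show i: "(\<lambda>t. (1 / (1 - t\<^sup>2)\<^sup>2)\<^sup>2) integrable_on {a..b}"
      using pos by (intro integrable_continuous_real continuous_intros) force
    have "((\<lambda>t. (1 + 5 * t\<^sup>2) / (1 - t\<^sup>2) ^ 4) has_integral \<Phi> b - \<Phi> a) {a..b}"
    proof (rule fundamental_theorem_of_calculus[OF ab(2)])
      fix t assume "t \<in> {a..b}"
      then have p: "1 - t\<^sup>2 \<noteq> 0" using pos by force
      have "(\<Phi> has_real_derivative (1 + 5 * t\<^sup>2) / (1 - t\<^sup>2) ^ 4) (at t)"
      proof -
        define q where "q = 1 - t\<^sup>2"
        have "(\<Phi> has_real_derivative (1 * q ^ 3 - t * (3 * q\<^sup>2 * (- 2 * t))) / (q ^ 3 * q ^ 3)) (at t)"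
          unfolding \<Phi>_def[abs_def] q_def using p
          by (intro DERIV_divide) (auto intro!: derivative_eq_intros)
        moreover have "1 * q ^ 3 - t * (3 * q\<^sup>2 * (- 2 * t)) = q\<^sup>2 * (1 + 5 * t\<^sup>2)"
          unfolding q_def by (simp add: power2_eq_square power3_eq_cube algebra_simps)
        moreover have "q ^ 3 * q ^ 3 = q\<^sup>2 * q ^ 4" by (simp flip: power_add)
        ultimately have "(\<Phi> has_real_derivative (q\<^sup>2 * (1 + 5 * t\<^sup>2)) / (q\<^sup>2 * q ^ 4)) (at t)"
          by (simp only:)
        moreover have "q\<^sup>2 * (1 + 5 * t\<^sup>2) / (q\<^sup>2 * q ^ 4) = (1 + 5 * t\<^sup>2) / q ^ 4"
          using p unfolding q_def by (intro nonzero_mult_divide_mult_cancel_left) simp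
        ultimately show ?thesis unfolding q_def[symmetric] by (simp only:)
      qed
      then show "(\<Phi> has_vector_derivative (1 + 5 * t\<^sup>2) / (1 - t\<^sup>2) ^ 4) (at t within {a..b})"
        by (simp add: has_real_derivative_iff_has_vector_derivative has_vector_derivative_at_within)
    qed
    then have "integral {a..b} (\<lambda>t. (1 / (1 - t\<^sup>2)\<^sup>2)\<^sup>2) \<le> \<Phi> b - \<Phi> a"
    proof (rule has_integral_le[OF integrable_integral[OF i]])
      fix t assume "t \<in> {a..b}"
      then show "(1 / (1 - t\<^sup>2)\<^sup>2)\<^sup>2 \<le> (1 + 5 * t\<^sup>2) / (1 - t\<^sup>2) ^ 4"
        using pos[of t] by (simp add: power_one_over power_mult[symmetric] divide_right_mono)
    qed
    then show "integral {a..b} (\<lambda>t. (1 / (1 - t\<^sup>2)\<^sup>2)\<^sup>2) \<le> R" using ab by simp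
  qed fact
  fix x assume x: "x \<in> II"
  have x': "-1 < x" "x < 1" and p: "0 < 1 - x\<^sup>2" using x weight_pos unfolding II_def by auto
  define q where "q = (1 - x\<^sup>2) ^ 3"
  have q: "0 < q" "q \<le> 1" using p unfolding q_def by (auto intro: power_le_one)
  have "(norm (v x - v 0))\<^sup>2 \<le> 1 / q * W"
  proof (cases "0 \<le> x")
    case True
    have "\<Phi> x - \<Phi> 0 \<le> 1 / q" using q x' unfolding \<Phi>_def q_def[symmetric] by (simp add: divide_right_mono)
    then show ?thesis using int[of 0 x "1/q"] True x' q by simp
  next
    case False
    have "\<Phi> 0 - \<Phi> x \<le> 1 / q" using q x' unfolding \<Phi>_def q_def[symmetric] by (simp add: field_simps)
    then show ?thesis using int[of x 0 "1/q"] False x' q by (simp add: norm_minus_commute)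
  qed
  then have 1: "q * (norm (v x - v 0))\<^sup>2 \<le> W" using q by (simp add: field_simps)
  have "norm (v x) \<le> norm (v x - v 0) + norm (v 0)" by (metis diff_add_cancel norm_triangle_ineq)
  then have "(norm (v x))\<^sup>2 \<le> (norm (v x - v 0) + norm (v 0))\<^sup>2" by (intro power_mono) auto
  also have "\<dots> \<le> 2 * (norm (v x - v 0))\<^sup>2 + 2 * (norm (v 0))\<^sup>2"
    using zero_le_power2[of "norm (v x - v 0) - norm (v 0)"] by (simp add: power2_eq_square algebra_simps)
  finally have "q * (norm (v x))\<^sup>2 \<le> q * (2 * (norm (v x - v 0))\<^sup>2 + 2 * (norm (v 0))\<^sup>2)"
    using q by (intro mult_left_mono) auto
  also have "\<dots> = 2 * (q * (norm (v x - v 0))\<^sup>2) + 2 * (q * (norm (v 0))\<^sup>2)" by (simp add: algebra_simps)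
  also have "\<dots> \<le> 2 * W + 2 * (norm (v 0))\<^sup>2"
    using 1 q mult_right_mono[OF q(2), of "(norm (v 0))\<^sup>2"] by (intro add_mono) auto
  finally show "(1 - x\<^sup>2) ^ 3 * (norm (v x))\<^sup>2 \<le> 2 * W + 2 * (norm (v 0))\<^sup>2" unfolding q_def .
qed

section \<open>Pointwise bounds from bounds of the derivative\<close>

lemma C1_increment_bound:
  assumes f: "\<And>x. x \<in> II \<Longrightarrow> (f has_vector_derivative f' x) (at x)"
    and \<phi>: "\<And>x. x \<in> II \<Longrightarrow> (\<phi> has_real_derivative \<phi>' x) (at x)"
    and le: "\<And>x. x \<in> II \<Longrightarrow> norm (f' x) \<le> \<phi>' x"
    and ab: "-1 < a" "a \<le> b" "b < 1"
  shows "norm (f b - f a) \<le> \<phi> b - \<phi> a"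
proof (cases "a = b")
  case False
  then have lt: "a < b" using ab by simp
  have sub: "{a..b} \<subseteq> II" using ab unfolding II_def by auto
  show ?thesis
  proof (rule differentiable_bound_general[OF lt])
    show "continuous_on {a..b} f"
      using f sub has_vector_derivative_continuous by (intro continuous_at_imp_continuous_on) blast
    show "continuous_on {a..b} \<phi>"
      using \<phi> sub DERIV_isCont by (intro continuous_at_imp_continuous_on) blast
    fix x assume "a < x" "x < b"
    then have "x \<in> II" using sub by auto
    then show "(f has_vector_derivative f' x) (at x)" "(\<phi> has_vector_derivative \<phi>' x) (at x)" "norm (f' x) \<le> \<phi>' x"
      using f \<phi> le by (simp_all flip: has_real_derivative_iff_has_vector_derivative)
  qed
qed simp

lemma C1_bound_from_0:
  assumes f: "\<And>x. x \<in> II \<Longrightarrow> (f has_vector_derivative f' x) (at x)"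
    and \<phi>: "\<And>x. x \<in> II \<Longrightarrow> (\<phi> has_real_derivative \<phi>' x) (at x)"
    and le: "\<And>x. x \<in> II \<Longrightarrow> norm (f' x) \<le> \<phi>' x" and x: "x \<in> II"
  shows "norm (f x) \<le> norm (f 0) + \<bar>\<phi> x - \<phi> 0\<bar>"
proof -
  have "norm (f x - f 0) \<le> \<bar>\<phi> x - \<phi> 0\<bar>"
    using C1_increment_bound[OF f \<phi> le, of 0 x] C1_increment_bound[OF f \<phi> le, of x 0] x
    unfolding II_def by (cases "0 \<le> x") (auto simp: norm_minus_commute)
  then show ?thesis using norm_triangle_sub[of "f x" "f 0"] by linarith
qed

text \<open>The bound by \<open>M\<close> times the distance to the nearer end point is immediate;
  that distance is at most the weight.\<close>

lemma C1_decay: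
  fixes f :: "real \<Rightarrow> complex"
  assumes f: "\<And>x. x \<in> II \<Longrightarrow> (f has_vector_derivative f' x) (at x)"
    and le: "\<And>x. x \<in> II \<Longrightarrow> norm (f' x) \<le> M"
    and lim: "(f \<longlongrightarrow> 0) (at_left 1)" "(f \<longlongrightarrow> 0) (at_right (-1))" and x: "x \<in> II"
  shows "norm (f x) \<le> M * (1 - x\<^sup>2)"
proof -
  have M: "0 \<le> M" using le[OF x] norm_ge_zero[of "f' x"] by linarith
  have inc: "norm (f b - f a) \<le> M * b - M * a" if "-1 < a" "a < b" "b < 1" for a b
    by (rule C1_increment_bound[OF f _ le]) (use that in \<open>auto intro!: derivative_eq_intros\<close>)
  have x': "-1 < x" "x < 1" using x unfolding II_def by auto
  show ?thesis
  proof (cases "0 \<le> x")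
    case True
    have "norm (f x) \<le> M * (1 - x)"
    proof (rule norm_le_of_tendsto_0(1)[OF lim(1) x'(2)])
      fix y assume y: "x < y" "y < 1"
      have "M * y \<le> M * 1" using M y by (intro mult_left_mono) auto
      then show "norm (f y - f x) \<le> M * (1 - x)" using inc[of x y] x' y by (simp add: algebra_simps)
    qed
    also have "\<dots> \<le> M * (1 - x\<^sup>2)" using weight_lower(1)[OF x True] M by (rule mult_left_mono)
    finally show ?thesis .
  next
    case False
    have "norm (f x) \<le> M * (1 + x)"
    proof (rule norm_le_of_tendsto_0(2)[OF lim(2) x'(1)])
      fix y assume y: "-1 < y" "y < x"
      have "M * (-1) \<le> M * y" using M y by (intro mult_left_mono) auto
      then show "norm (f x - f y) \<le> M * (1 + x)" using inc[of y x] x' y by (simp add: algebra_simps)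
    qed
    also have "\<dots> \<le> M * (1 - x\<^sup>2)" using weight_lower(2)[OF x] False M by (intro mult_left_mono) auto
    finally show ?thesis .
  qed
qed

section \<open>A weighted Hardy inequality\<close>

text \<open>Monotone convergence along symmetric compact intervals; for a nonnegative function gauge
  integrability is already Lebesgue integrability.\<close>

lemma integrable_II_of_bounded_integrals:
  fixes h :: "real \<Rightarrow> real"
  assumes cont: "continuous_on II h" and nonneg: "\<And>x. x \<in> II \<Longrightarrow> 0 \<le> h x"
    and bound: "\<And>b. 0 \<le> b \<Longrightarrow> b < 1 \<Longrightarrow> integral {-b..b} h \<le> M"
  shows "integrable (lebesgue_on II) h"
proof -
  define b where "b k = 1 - 1 / real (Suc k)" for k
  have b: "0 \<le> b k" "b k < 1" "b k \<le> b (Suc k)" for k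
    unfolding b_def by (auto simp: field_simps)
  have sub: "{- b k..b k} \<subseteq> II" for k using b[of k] unfolding II_def by auto
  have hi: "h integrable_on {- b k..b k}" for k
    using continuous_on_subset[OF cont sub] by (rule integrable_continuous_real)
  define f where "f k x = (if x \<in> {- b k..b k} then h x else 0)" for k x
  have I: "{- b k..b k} \<inter> II = {- b k..b k}" "II \<inter> {- b k..b k} = {- b k..b k}" for k
    using sub[of k] by blast+
  have int: "integral II (f k) = integral {- b k..b k} h" for k
    unfolding f_def by (simp only: integral_restrict_Int I)
  have "h integrable_on II \<and> ((\<lambda>k. integral II (f k)) \<longlonglongrightarrow> integral II h)"
  proof (rule monotone_convergence_increasing)
    show "f k integrable_on II" for k
      unfolding f_def using hi[of k] by (simp only: integrable_restrict_Int I)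
    show "f k x \<le> f (Suc k) x" if "x \<in> II" for k x
      using b(3)[of k] nonneg[OF that] unfolding f_def by auto
    show "(\<lambda>k. f k x) \<longlonglongrightarrow> h x" if x: "x \<in> II" for x
    proof (rule tendsto_eventually)
      have "\<bar>x\<bar> < 1" using x unfolding II_def by auto
      moreover have "b \<longlonglongrightarrow> 1 - 0"
        unfolding b_def by (intro tendsto_intros lim_inverse_n'[THEN LIMSEQ_Suc, unfolded inverse_eq_divide])
      ultimately have "\<forall>\<^sub>F k in sequentially. \<bar>x\<bar> < b k" by (intro order_tendstoD) auto
      then show "\<forall>\<^sub>F k in sequentially. f k x = h x" by eventually_elim (auto simp: f_def)
    qed
    have "\<bar>integral II (f k)\<bar> \<le> M" for k
    proof -
      have "0 \<le> integral {- b k..b k} h"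
        using sub[of k] nonneg by (intro Henstock_Kurzweil_Integration.integral_nonneg hi) auto
      then show ?thesis using bound[OF b(1,2)] unfolding int by simp
    qed
    then show "bounded (range (\<lambda>k. integral II (f k)))" by (auto intro: boundedI[where B=M])
  qed
  then have "h absolutely_integrable_on II" using nonneg by (intro nonnegative_absolutely_integrable_1) auto
  then show ?thesis
    using II_facts(1) by (simp add: set_integrable_def integrable_restrict_space)
qed

text \<open>Here \<open>e\<close> is the derivative of t p^n |v|^2, with \<open>d\<close> as the
  derivative of \<open>v\<close>. Its main term is -2n times the Hardy integrand. The term with
  \<open>d\<close> costs at most one copy of that integrand plus \<open>\<omega>\<^sup>2\<close>,
  because n = m + (m + 1) splits the weight. The factor \<open>sgn n\<close> orients the
  inequality.\<close>

lemma Hardy_pointwise: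
  fixes p t e C \<omega> :: real and v d :: complex and m n :: int
  assumes p: "0 < p" "p = 1 - t\<^sup>2" and t: "\<bar>t\<bar> \<le> 1" and n: "n = 2 * m + 1"
    and C: "p powi n * (norm v)\<^sup>2 \<le> C" and w: "p powi (m + 1) * norm d \<le> \<omega>"
    and e: "e = ((1 + 2 * n) * p powi n - 2 * n * p powi (n - 1)) * (norm v)\<^sup>2 + 2 * t * p powi n * Re (d * cnj v)"
  shows "(norm (p powi m *\<^sub>R v))\<^sup>2 \<le> \<bar>1 + 2 * n\<bar> * C + \<omega>\<^sup>2 - sgn n * e"
proof -
  define h where "h = (norm (p powi m *\<^sub>R v))\<^sup>2"
  define X where "X = p powi n * (norm v)\<^sup>2"
  define Y where "Y = 2 * t * p powi n * Re (d * cnj v)"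
  have h0: "0 \<le> h" unfolding h_def by simp
  have h: "h = p powi (n - 1) * (norm v)\<^sup>2"
  proof -
    have "n - 1 = m + m" unfolding n by simp
    then have "p powi (n - 1) = (p powi m)\<^sup>2"
      using p(1) power_int_add[of p m m] by (simp add: power2_eq_square)
    then show ?thesis unfolding h_def by (simp add: power_mult_distrib)
  qed
  have X: "0 \<le> X" "X \<le> C" using p(1) C unfolding X_def by auto
  have Y: "\<bar>Y\<bar> \<le> h + \<omega>\<^sup>2"
  proof -
    have "\<bar>Y\<bar> = 2 * \<bar>t\<bar> * p powi n * \<bar>Re (d * cnj v)\<bar>" using p(1) unfolding Y_def by (simp add: abs_mult)
    also have "\<dots> \<le> 2 * 1 * p powi n * (norm d * norm v)"
      using p(1) t abs_Re_le_cmod[of "d * cnj v"] by (intro mult_mono) (auto simp: norm_mult)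
    also have "\<dots> = 2 * (p powi m * norm v) * (p powi (m + 1) * norm d)"
    proof -
      have "n = m + (m + 1)" unfolding n by simp
      then have "p powi n = p powi m * p powi (m + 1)"
        using p(1) power_int_add[of p m "m + 1"] by simp
      then show ?thesis by simp
    qed
    also have "\<dots> \<le> (p powi m * norm v)\<^sup>2 + (p powi (m + 1) * norm d)\<^sup>2"
      using zero_le_power2[of "p powi m * norm v - p powi (m + 1) * norm d"]
      unfolding power2_diff by linarith
    also have "\<dots> \<le> h + \<omega>\<^sup>2"
    proof (rule add_mono)
      show "(p powi m * norm v)\<^sup>2 \<le> h" unfolding h_def by (simp add: power_mult_distrib)
      show "(p powi (m + 1) * norm d)\<^sup>2 \<le> \<omega>\<^sup>2" using w p(1) by (intro power_mono) auto
    qed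
    finally show ?thesis .
  qed
  have e': "e = (1 + 2 * n) * X - 2 * n * h + Y"
    unfolding e h X_def Y_def by (simp add: algebra_simps)
  have cX: "\<bar>real_of_int (1 + 2 * n) * X\<bar> \<le> \<bar>1 + 2 * n\<bar> * C"
    using X by (simp add: abs_mult mult_left_mono)
  \<comment> \<open>Oddness gives |n| at least 1, so at least one copy of \<open>h\<close> is left
    after 2|n| copies have paid for the one in the bound of \<open>Y\<close>.\<close>
  have "n \<noteq> 0" unfolding n by presburger
  then consider "1 \<le> n" | "n \<le> -1" by linarith
  then have "h \<le> \<bar>1 + 2 * n\<bar> * C + \<omega>\<^sup>2 - sgn n * e"
  proof cases
    case 1
    then have "1 * h \<le> real_of_int (2 * n - 1) * h" using h0 by (intro mult_right_mono) auto
    moreover have "real_of_int (2 * n - 1) * h = (1 + 2 * n) * X + Y - h - e" unfolding e' by (simp add: algebra_simps)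
    ultimately have "h \<le> (1 + 2 * n) * X + Y - h - e" by simp
    moreover have "sgn n = 1" using 1 by simp
    ultimately show ?thesis using cX Y by auto
  next
    case 2
    then have "1 * h \<le> real_of_int (- 2 * n - 1) * h" using h0 by (intro mult_right_mono) auto
    moreover have "real_of_int (- 2 * n - 1) * h = - ((1 + 2 * n) * X) - Y - h + e" unfolding e' by (simp add: algebra_simps)
    ultimately have "h \<le> - ((1 + 2 * n) * X) - Y - h + e" by simp
    moreover have "sgn n = -1" using 2 by simp
    ultimately show ?thesis using cX Y by auto
  qed
  then show ?thesis unfolding h_def .
qed

text \<open>Integrating the derivative of \<open>x (1 - x\<^sup>2)\<^sup>n |v|\<^sup>2\<close>, \<open>n = 2m + 1\<close>, treats both end points at once.
  The assumed pointwise bound controls the boundary terms.\<close>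

theorem Hardy_inequality:
  fixes m :: int
  assumes v: "v \<in> AC_loc" and w: "w \<in> L2" and N: "negligible N"
    and bound: "\<And>t. t \<in> II - N \<Longrightarrow> (1 - t\<^sup>2) powi (m + 1) * norm (D v t) \<le> norm (w t)"
    and C: "\<And>t. t \<in> II \<Longrightarrow> (1 - t\<^sup>2) powi (2 * m + 1) * (norm (v t))\<^sup>2 \<le> C"
  shows "(\<lambda>t. (1 - t\<^sup>2) powi m *\<^sub>R v t) \<in> L2"
proof -
  define n where "n = 2 * m + 1"
  define W where "W = integral II (\<lambda>t. (norm (w t))\<^sup>2)"
  define h where "h t = (norm ((1 - t\<^sup>2) powi m *\<^sub>R v t))\<^sup>2" for t
  define \<phi> where "\<phi> t = t * (1 - t\<^sup>2) powi n" for t :: real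
  \<comment> \<open>In the derivative of t p^n the factor t^2 is replaced by 1 - p. This separates
    the term in p^(n-1), which is the Hardy weight, from a term in p^n, which \<open>C\<close>
    controls.\<close>
  define \<phi>' where "\<phi>' t = (1 + 2 * n) * (1 - t\<^sup>2) powi n - 2 * n * (1 - t\<^sup>2) powi (n - 1)" for t :: real
  \<comment> \<open>The square of the norm is written as a product with the conjugate, so that
    closure of \<open>AC_loc\<close> under products and the product rule apply.\<close>
  define Q where "Q t = \<phi> t *\<^sub>R (v t * cnj (v t))" for t
  have p0: "1 - t\<^sup>2 \<noteq> 0" if "t \<in> II" for t using weight_pos[OF that] by simp
  have \<phi>: "(\<phi> has_real_derivative \<phi>' t) (at t)" if t: "t \<in> II" for t
  proof -
    define q P where "q = 1 - t\<^sup>2" and "P = q powi (n - 1)"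
    have qn: "q powi n = P * q"
      using p0[OF t] power_int_add[of q "n - 1" 1] unfolding q_def P_def by simp
    have tt: "t * t = 1 - q" unfolding q_def by (simp add: power2_eq_square)
    have "1 * q powi n + t * (n * P * (- 2 * t)) = P * q - 2 * n * P * (t * t)"
      unfolding qn by (simp add: algebra_simps)
    also have "\<dots> = (1 + 2 * n) * q powi n - 2 * n * P" unfolding tt qn by (simp add: algebra_simps)
    finally have "1 * (1 - t\<^sup>2) powi n + t * (n * (1 - t\<^sup>2) powi (n - 1) * (- 2 * t)) = \<phi>' t"
      unfolding \<phi>'_def P_def q_def .
    moreover have "(\<phi> has_real_derivative 1 * (1 - t\<^sup>2) powi n + t * (n * (1 - t\<^sup>2) powi (n - 1) * (- 2 * t))) (at t)"
      unfolding \<phi>_def[abs_def] using p0[OF t] by (auto intro!: derivative_eq_intros)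
    ultimately show ?thesis by simp
  qed
  have \<phi>'c: "continuous_on II \<phi>'"
    unfolding \<phi>'_def[abs_def] using p0 by (intro continuous_intros) auto
  have Q: "Q \<in> AC_loc"
    unfolding Q_def[abs_def] by (intro AC_loc_scaleR[OF \<phi> \<phi>'c] AC_loc_mult AC_loc_cnj v)
  define N' where "N' = N \<union> {x \<in> II. \<not> v differentiable (at x)}"
  have N': "negligible N'" unfolding N'_def using N AC_loc_differentiable_ae[OF v] by (rule negligible_Un)
  have vc: "continuous_on II v" by (rule AC_loc_continuous_on[OF v])
  have uc: "continuous_on II (\<lambda>t. (1 - t\<^sup>2) powi m *\<^sub>R v t)"
    using p0 by (intro continuous_intros vc) auto
  have hc: "continuous_on II h" unfolding h_def[abs_def] by (intro continuous_intros uc)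
  define A where "A = \<bar>1 + 2 * n\<bar> * C"
  have key: "h t \<le> A + (norm (w t))\<^sup>2 - sgn n * Re (D Q t)" if t: "t \<in> II - N'" for t
  proof -
    have tI: "t \<in> II" and tN: "t \<in> II - N" using t unfolding N'_def by auto
    have d: "(v has_vector_derivative D v t) (at t)" using t unfolding N'_def by (intro D_works) auto
    have dc: "((\<lambda>t. cnj (v t)) has_vector_derivative cnj (D v t)) (at t)"
      using bounded_linear.has_vector_derivative[OF bounded_linear_cnj d] .
    have "(Q has_vector_derivative \<phi> t *\<^sub>R (v t * cnj (D v t) + D v t * cnj (v t)) + \<phi>' t *\<^sub>R (v t * cnj (v t))) (at t)"
      unfolding Q_def[abs_def] by (intro has_vector_derivative_scaleR \<phi>[OF tI] has_vector_derivative_mult d dc)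
    then have "D Q t = \<phi> t *\<^sub>R (v t * cnj (D v t) + D v t * cnj (v t)) + \<phi>' t *\<^sub>R (v t * cnj (v t))"
      by (rule D_eq)
    moreover have "Re (a *\<^sub>R (z * cnj d + d * cnj z) + b *\<^sub>R (z * cnj z)) = b * (norm z)\<^sup>2 + 2 * a * Re (d * cnj z)"
      for a b z d by (simp add: cmod_power2) (simp add: power2_eq_square algebra_simps)
    ultimately have "Re (D Q t) = \<phi>' t * (norm (v t))\<^sup>2 + 2 * \<phi> t * Re (D v t * cnj (v t))" by simp
    then have "Re (D Q t) = ((1 + 2 * n) * (1 - t\<^sup>2) powi n - 2 * n * (1 - t\<^sup>2) powi (n - 1)) * (norm (v t))\<^sup>2
        + 2 * t * (1 - t\<^sup>2) powi n * Re (D v t * cnj (v t))"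
      unfolding \<phi>_def \<phi>'_def by (simp only: mult.assoc)
    from Hardy_pointwise[OF weight_pos[OF tI] refl _ n_def C[OF tI, folded n_def] bound[OF tN] this]
    show ?thesis using tI unfolding h_def A_def II_def by auto
  qed
  have "integral {-b..b} h \<le> 2 * \<bar>A\<bar> + W + 2 * C" if b: "0 \<le> b" "b < 1" for b
  proof -
    have sub: "{-b..b} \<subseteq> II" using b unfolding II_def by auto
    define r where "r t = A + (norm (w t))\<^sup>2 - sgn n * Re (D Q t)" for t
    define r' where "r' t = (if t \<in> N' then h t else r t)" for t
    have "(D Q has_integral Q b - Q (-b)) {-b..b}"
      using b by (intro abs_cont_on_has_integral AC_locD[OF Q]) auto
    then have "((\<lambda>t. Re (D Q t)) has_integral Re (Q b - Q (-b))) {-b..b}"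
      by (rule has_integral_Re)
    moreover have "((\<lambda>t. A) has_integral 2 * b * A) {-b..b}"
      using has_integral_const_real[of A "-b" b] b by simp
    ultimately have "(r has_integral 2 * b * A + integral {-b..b} (\<lambda>t. (norm (w t))\<^sup>2) - sgn n * Re (Q b - Q (-b))) {-b..b}"
      unfolding r_def[abs_def]
      by (intro has_integral_diff has_integral_add has_integral_mult_right integrable_integral L2_subinterval(1)[OF w sub])
    then have r': "(r' has_integral 2 * b * A + integral {-b..b} (\<lambda>t. (norm (w t))\<^sup>2) - sgn n * Re (Q b - Q (-b))) {-b..b}"
      by (rule has_integral_spike[OF N', rotated]) (auto simp: r'_def)
    have "h integrable_on {-b..b}" by (rule integrable_continuous_real[OF continuous_on_subset[OF hc sub]])
    then have "integral {-b..b} h \<le> 2 * b * A + integral {-b..b} (\<lambda>t. (norm (w t))\<^sup>2) - sgn n * Re (Q b - Q (-b))"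
    proof (rule has_integral_le[OF integrable_integral r'])
      show "h t \<le> r' t" if "t \<in> {-b..b}" for t
        using key[of t] sub that unfolding r'_def r_def by auto
    qed
    moreover have "2 * b * A \<le> 2 * \<bar>A\<bar>"
    proof -
      have "b * A \<le> b * \<bar>A\<bar>" using b by (intro mult_left_mono) auto
      moreover have "b * \<bar>A\<bar> \<le> \<bar>A\<bar>" using b by (intro mult_left_le_one_le) auto
      ultimately show ?thesis by simp
    qed
    moreover have Qb: "\<bar>Re (Q s)\<bar> \<le> C" if "s \<in> II" for s
    proof -
      have "Re (Q s) = s * ((1 - s\<^sup>2) powi n * (norm (v s))\<^sup>2)"
        unfolding Q_def \<phi>_def complex_norm_square[symmetric] by (simp only: Re_complex_of_real scaleR_complex.sel mult.assoc)
      also have "\<bar>\<dots>\<bar> = \<bar>s\<bar> * ((1 - s\<^sup>2) powi n * (norm (v s))\<^sup>2)"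
        using weight_pos[OF that] by (simp add: abs_mult)
      also have "\<dots> \<le> 1 * C"
        using that weight_pos[OF that] C[OF that] unfolding n_def II_def by (intro mult_mono) auto
      finally show ?thesis by simp
    qed
    have "b \<in> II" "-b \<in> II" using b unfolding II_def by auto
    from Qb[OF this(1)] Qb[OF this(2)] have "\<bar>Re (Q b - Q (-b))\<bar> \<le> 2 * C" by simp
    then have "- (sgn n * Re (Q b - Q (-b))) \<le> 2 * C" by (auto simp: sgn_if abs_le_iff)
    ultimately show ?thesis using L2_subinterval(2)[OF w sub] unfolding W_def by linarith
  qed
  then have "integrable (lebesgue_on II) h"
    by (intro integrable_II_of_bounded_integrals[OF hc]) (auto simp: h_def)
  then show ?thesis
    unfolding L2_def h_def[abs_def] using continuous_imp_measurable_on_sets_lebesgue[OF uc II_facts(1)] by simp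
qed

section \<open>The two descriptions of the domain\<close>

lemma AC3_locD:
  assumes "f \<in> AC3_loc"
  shows "\<And>x. x \<in> II \<Longrightarrow> (f has_vector_derivative D f x) (at x)"
    and "\<And>x. x \<in> II \<Longrightarrow> (D f has_vector_derivative D (D f) x) (at x)"
    and "\<And>x. x \<in> II \<Longrightarrow> (D (D f) has_vector_derivative D (D (D f)) x) (at x)"
    and "f \<in> AC_loc" "D f \<in> AC_loc" "D (D f) \<in> AC_loc" "D (D (D f)) \<in> AC_loc"
proof -
  have d: "(D ^^ k) f differentiable (at x)" if "k < 3" "x \<in> II" for k x
    using assms that unfolding AC3_loc_def by blast
  have a: "(D ^^ k) f \<in> AC_loc" if "k \<le> 3" for k
    using assms that unfolding AC3_loc_def by blast
  show "(f has_vector_derivative D f x) (at x)" if "x \<in> II" for x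
    using d[of 0 x] that by (intro D_works) simp
  show "(D f has_vector_derivative D (D f) x) (at x)" if "x \<in> II" for x
    using d[of 1 x] that by (intro D_works) simp
  show "(D (D f) has_vector_derivative D (D (D f)) x) (at x)" if "x \<in> II" for x
    using d[of 2 x] that by (intro D_works) (simp add: numeral_2_eq_2)
  show "f \<in> AC_loc" "D f \<in> AC_loc" "D (D f) \<in> AC_loc" "D (D (D f)) \<in> AC_loc"
    using a[of 0] a[of 1] a[of 2] a[of 3] by (simp_all add: numeral_2_eq_2 numeral_3_eq_3)
qed

section \<open>The form [f,1] and the expression l^2[f]\<close>

text \<open>This is [f,1] on \<open>II\<close> with the derivative of p^2 f'' carried out. In this
  form it is visibly a combination of elements of \<open>AC_loc\<close> with polynomial
  coefficients.\<close>

definition boundary_form :: "(real \<Rightarrow> complex) \<Rightarrow> real \<Rightarrow> complex" where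
  "boundary_form f x = (1 - x\<^sup>2)\<^sup>2 *\<^sub>R D (D (D f)) x - (4 * x * (1 - x\<^sup>2)) *\<^sub>R D (D f) x - (2 * (1 - x\<^sup>2)) *\<^sub>R D f x"

lemma D_leading:
  assumes "f \<in> AC3_loc" "x \<in> II"
  shows "((\<lambda>t. (1 - t\<^sup>2)\<^sup>2 *\<^sub>R D (D f) t) has_vector_derivative
    (1 - x\<^sup>2)\<^sup>2 *\<^sub>R D (D (D f)) x - (4 * x * (1 - x\<^sup>2)) *\<^sub>R D (D f) x) (at x)"
  by (rule derivative_eq_intros AC3_locD(3)[OF assms] refl)+ (simp add: algebra_simps)

lemma sesq_form_one_boundary_form:
  assumes "f \<in> AC3_loc" "x \<in> II"
  shows "sesq_form f (\<lambda>_. 1) x = boundary_form f x"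
  unfolding sesq_form_one boundary_form_def D_eq[OF D_leading[OF assms]] ..

lemma legendre_sq_boundary_form:
  assumes f: "f \<in> AC3_loc" and x: "x \<in> II" and d: "D (D (D f)) differentiable (at x)"
  shows "legendre_sq f x = (1 - x\<^sup>2)\<^sup>2 *\<^sub>R D (D (D (D f))) x - (8 * x * (1 - x\<^sup>2)) *\<^sub>R D (D (D f)) x
      + (12 * x\<^sup>2 - 4) *\<^sub>R D (D f) x - (2 * (1 - x\<^sup>2)) *\<^sub>R D (D f) x + (4 * x) *\<^sub>R D f x" (is "_ = ?R")
    and "D (boundary_form f) x = legendre_sq f x"
proof -
  note d4 = D_works[OF d]
  have 1: "((\<lambda>t. (1 - t\<^sup>2)\<^sup>2 *\<^sub>R D (D (D f)) t - (4 * t * (1 - t\<^sup>2)) *\<^sub>R D (D f) t) has_vector_derivative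
     (1 - x\<^sup>2)\<^sup>2 *\<^sub>R D (D (D (D f))) x - (8 * x * (1 - x\<^sup>2)) *\<^sub>R D (D (D f)) x + (12 * x\<^sup>2 - 4) *\<^sub>R D (D f) x) (at x)"
    by (rule derivative_eq_intros AC3_locD(3)[OF f x] d4 refl)+
      (simp add: scaleR_conv_of_real algebra_simps power2_eq_square)
  have 2: "((\<lambda>t. (1 - t\<^sup>2) *\<^sub>R D f t) has_vector_derivative (1 - x\<^sup>2) *\<^sub>R D (D f) x - (2 * x) *\<^sub>R D f x) (at x)"
    by (rule derivative_eq_intros AC3_locD(2)[OF f x] refl)+ (simp add: algebra_simps)
  \<comment> \<open>The inner derivative has its product rule form only on \<open>II\<close>, hence
    the passage through \<open>D_cong\<close> before differentiating again.\<close>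
  have "D (D (\<lambda>t. (1 - t\<^sup>2)\<^sup>2 *\<^sub>R D (D f) t)) x =
      D (\<lambda>t. (1 - t\<^sup>2)\<^sup>2 *\<^sub>R D (D (D f)) t - (4 * t * (1 - t\<^sup>2)) *\<^sub>R D (D f) t) x"
    by (rule D_cong[OF D_eq[OF D_leading[OF f]] x])
  then have 3: "legendre_sq f x = ((1 - x\<^sup>2)\<^sup>2 *\<^sub>R D (D (D (D f))) x - (8 * x * (1 - x\<^sup>2)) *\<^sub>R D (D (D f)) x
      + (12 * x\<^sup>2 - 4) *\<^sub>R D (D f) x) - 2 * ((1 - x\<^sup>2) *\<^sub>R D (D f) x - (2 * x) *\<^sub>R D f x)"
    unfolding legendre_sq_def D_eq[OF 1] D_eq[OF 2] by (simp only: D_eq[OF 1])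
  then show "legendre_sq f x = ?R" by (simp add: scaleR_conv_of_real algebra_simps)
  have eq: "boundary_form f = (\<lambda>t. ((1 - t\<^sup>2)\<^sup>2 *\<^sub>R D (D (D f)) t - (4 * t * (1 - t\<^sup>2)) *\<^sub>R D (D f) t)
      - 2 * ((1 - t\<^sup>2) *\<^sub>R D f t))"
    by (simp add: boundary_form_def fun_eq_iff scaleR_conv_of_real)
  show "D (boundary_form f) x = legendre_sq f x"
    unfolding 3 eq by (intro D_eq has_vector_derivative_diff[OF 1] has_vector_derivative_mult_right[OF 2])
qed

lemma boundary_form_AC_loc:
  assumes f: "f \<in> AC3_loc"
  shows "boundary_form f \<in> AC_loc"
proof -
  have eq: "boundary_form f = (\<lambda>x. ((1 - x\<^sup>2)\<^sup>2 *\<^sub>R D (D (D f)) x + (- 4 * x * (1 - x\<^sup>2)) *\<^sub>R D (D f) x) + (- 2 * (1 - x\<^sup>2)) *\<^sub>R D f x)"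
    by (simp add: boundary_form_def fun_eq_iff scaleR_conv_of_real algebra_simps)
  have 1: "((\<lambda>x. (1 - x\<^sup>2)\<^sup>2) has_real_derivative - 4 * x * (1 - x\<^sup>2)) (at x)"
    "((\<lambda>x. - 4 * x * (1 - x\<^sup>2)) has_real_derivative 12 * x\<^sup>2 - 4) (at x)"
    "((\<lambda>x. - 2 * (1 - x\<^sup>2)) has_real_derivative 4 * x) (at x)" for x :: real
    by (auto intro!: derivative_eq_intros simp: power2_eq_square algebra_simps)
  show ?thesis
    unfolding eq
    by (intro AC_loc_add AC_loc_scaleR[OF 1(1)] AC_loc_scaleR[OF 1(2)] AC_loc_scaleR[OF 1(3)] AC3_locD[OF f] continuous_intros)
qed

section \<open>Estimates by powers of the weight\<close>

lemma tendsto_0_of_sqrt_weight: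
  fixes g :: "real \<Rightarrow> complex"
  assumes "\<And>x. x \<in> II \<Longrightarrow> norm (g x) \<le> K * sqrt (1 - x\<^sup>2)"
  shows "(g \<longlongrightarrow> 0) (at_left 1)" "(g \<longlongrightarrow> 0) (at_right (-1))"
proof -
  have "((\<lambda>x::real. K * sqrt (1 - x\<^sup>2)) \<longlongrightarrow> K * sqrt (1 - 1\<^sup>2)) (at_left 1)"
    "((\<lambda>x::real. K * sqrt (1 - x\<^sup>2)) \<longlongrightarrow> K * sqrt (1 - (-1)\<^sup>2)) (at_right (-1))"
    by (intro tendsto_intros)+
  then have l: "((\<lambda>x::real. K * sqrt (1 - x\<^sup>2)) \<longlongrightarrow> 0) (at_left 1)"
    "((\<lambda>x::real. K * sqrt (1 - x\<^sup>2)) \<longlongrightarrow> 0) (at_right (-1))" by simp_all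
  have e: "\<forall>\<^sub>F x in at_left 1. x \<in> II" "\<forall>\<^sub>F x in at_right (-1). x \<in> II"
    using eventually_at_left_real[of "-1" 1] eventually_at_right_real[of "-1" 1] unfolding II_def by simp_all
  show "(g \<longlongrightarrow> 0) (at_left 1)"
    by (rule Lim_null_comparison[OF _ l(1)]) (use e(1) assms in \<open>auto elim: eventually_mono\<close>)
  show "(g \<longlongrightarrow> 0) (at_right (-1))"
    by (rule Lim_null_comparison[OF _ l(2)]) (use e(2) assms in \<open>auto elim: eventually_mono\<close>)
qed

lemma sqrt_weight:
  assumes "x \<in> II"
  shows "0 < sqrt (1 - x\<^sup>2)" "sqrt (1 - x\<^sup>2) \<le> 1" "sqrt (1 - x\<^sup>2) * sqrt (1 - x\<^sup>2) = 1 - x\<^sup>2"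
    "1 - x\<^sup>2 \<le> sqrt (1 - x\<^sup>2)" "\<bar>x\<bar> \<le> 1"
proof -
  have p: "0 < 1 - x\<^sup>2" using weight_pos[OF assms] .
  then show s: "0 < sqrt (1 - x\<^sup>2)" "sqrt (1 - x\<^sup>2) \<le> 1" "sqrt (1 - x\<^sup>2) * sqrt (1 - x\<^sup>2) = 1 - x\<^sup>2" by auto
  then show "1 - x\<^sup>2 \<le> sqrt (1 - x\<^sup>2)" using mult_left_le[of "sqrt (1 - x\<^sup>2)" "sqrt (1 - x\<^sup>2)"] by simp
  show "\<bar>x\<bar> \<le> 1" using assms unfolding II_def by auto
qed

lemma DERIV_weight_primitives:
  assumes "x \<in> II"
  shows "((\<lambda>x. c * (x / sqrt (1 - x\<^sup>2))) has_real_derivative c / ((1 - x\<^sup>2) * sqrt (1 - x\<^sup>2))) (at x)"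
    and "((\<lambda>x. c * arcsin x) has_real_derivative c / sqrt (1 - x\<^sup>2)) (at x)"
    and "((\<lambda>x. c * x) has_real_derivative c) (at x)"
proof -
  define q s where "q = 1 - x\<^sup>2" and "s = sqrt q"
  have s: "0 < s" "s * s = q" "0 < q"
    using sqrt_weight(1,3)[OF assms] weight_pos[OF assms] unfolding s_def q_def by auto
  have "((\<lambda>x. x / sqrt (1 - x\<^sup>2)) has_real_derivative (1 * s - x * (- 2 * x * inverse s / 2)) / (s * s)) (at x)"
    unfolding s_def q_def using s(1,3) unfolding s_def q_def
    by (intro DERIV_divide) (auto intro!: derivative_eq_intros)
  moreover have "(1 * s - x * (- 2 * x * inverse s / 2)) / (s * s) = 1 / (q * s)"
  proof -
    have "1 * s - x * (- 2 * x * inverse s / 2) = (s * s + x\<^sup>2) / s" using s(1) by (simp add: field_simps power2_eq_square)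
    also have "s * s + x\<^sup>2 = 1" unfolding s(2) q_def by simp
    finally show ?thesis using s by simp
  qed
  ultimately have "((\<lambda>x. x / sqrt (1 - x\<^sup>2)) has_real_derivative 1 / (q * s)) (at x)" by simp
  from DERIV_cmult[OF this, of c]
  show "((\<lambda>x. c * (x / sqrt (1 - x\<^sup>2))) has_real_derivative c / ((1 - x\<^sup>2) * sqrt (1 - x\<^sup>2))) (at x)"
    unfolding s_def q_def by simp
  show "((\<lambda>x. c * arcsin x) has_real_derivative c / sqrt (1 - x\<^sup>2)) (at x)"
    using DERIV_cmult[OF DERIV_arcsin[of x], of c] assms unfolding II_def by (simp add: divide_inverse)
  show "((\<lambda>x. c * x) has_real_derivative c) (at x)" by (auto intro!: derivative_eq_intros)
qed

text \<open>Integration from 0 gains one power of p: p^(-3/2) has the primitive x / sqrt p, and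
  p^(-1/2) has the bounded primitive arcsin. Chaining the three cases descends from f''' to
  f.\<close>

lemma bound_of_deriv_bound:
  fixes f f' :: "real \<Rightarrow> complex"
  assumes f: "\<And>x. x \<in> II \<Longrightarrow> (f has_vector_derivative f' x) (at x)" and c: "0 \<le> c"
  shows "(\<And>x. x \<in> II \<Longrightarrow> norm (f' x) \<le> c / ((1 - x\<^sup>2) * sqrt (1 - x\<^sup>2)))
          \<Longrightarrow> \<exists>c'\<ge>0. \<forall>x\<in>II. norm (f x) \<le> c' / sqrt (1 - x\<^sup>2)"
    and "(\<And>x. x \<in> II \<Longrightarrow> norm (f' x) \<le> c / sqrt (1 - x\<^sup>2)) \<Longrightarrow> \<exists>c'\<ge>0. \<forall>x\<in>II. norm (f x) \<le> c'"
    and "(\<And>x. x \<in> II \<Longrightarrow> norm (f' x) \<le> c) \<Longrightarrow> \<exists>c'\<ge>0. \<forall>x\<in>II. norm (f x) \<le> c'"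
proof -
  show "\<exists>c'\<ge>0. \<forall>x\<in>II. norm (f x) \<le> c' / sqrt (1 - x\<^sup>2)"
    if b: "\<And>x. x \<in> II \<Longrightarrow> norm (f' x) \<le> c / ((1 - x\<^sup>2) * sqrt (1 - x\<^sup>2))"
  proof (intro exI[of _ "norm (f 0) + c"] conjI ballI)
    fix x assume x: "x \<in> II"
    note s = sqrt_weight[OF x]
    have "norm (f x) \<le> norm (f 0) + \<bar>c * (x / sqrt (1 - x\<^sup>2)) - c * (0 / sqrt (1 - 0\<^sup>2))\<bar>"
      by (rule C1_bound_from_0[OF f DERIV_weight_primitives(1) b x])
    also have "\<dots> = norm (f 0) + c * \<bar>x\<bar> / sqrt (1 - x\<^sup>2)" using c s(1) by (simp add: abs_mult)
    also have "\<dots> \<le> norm (f 0) / sqrt (1 - x\<^sup>2) + c / sqrt (1 - x\<^sup>2)"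
      using s c mult_left_le[of "\<bar>x\<bar>" c] by (intro add_mono divide_right_mono) (auto simp: pos_le_divide_eq mult_left_le)
    finally show "norm (f x) \<le> (norm (f 0) + c) / sqrt (1 - x\<^sup>2)" by (simp add: add_divide_distrib)
  qed (use c in simp)
  show "\<exists>c'\<ge>0. \<forall>x\<in>II. norm (f x) \<le> c'" if b: "\<And>x. x \<in> II \<Longrightarrow> norm (f' x) \<le> c / sqrt (1 - x\<^sup>2)"
  proof (intro exI[of _ "norm (f 0) + c * (pi / 2)"] conjI ballI)
    fix x assume x: "x \<in> II"
    have "norm (f x) \<le> norm (f 0) + \<bar>c * arcsin x - c * arcsin 0\<bar>"
      by (rule C1_bound_from_0[OF f DERIV_weight_primitives(2) b x])
    also have "\<dots> = norm (f 0) + c * \<bar>arcsin x\<bar>" using c by (simp add: abs_mult)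
    also have "\<bar>arcsin x\<bar> \<le> pi / 2" using arcsin_bounded[of x] x unfolding II_def by auto
    finally show "norm (f x) \<le> norm (f 0) + c * (pi / 2)" using c by (simp add: mult_left_mono)
  qed (use c in simp)
  show "\<exists>c'\<ge>0. \<forall>x\<in>II. norm (f x) \<le> c'" if b: "\<And>x. x \<in> II \<Longrightarrow> norm (f' x) \<le> c"
  proof (intro exI[of _ "norm (f 0) + c"] conjI ballI)
    fix x assume x: "x \<in> II"
    have "norm (f x) \<le> norm (f 0) + \<bar>c * x - c * 0\<bar>"
      by (rule C1_bound_from_0[OF f DERIV_weight_primitives(3) b x])
    also have "\<dots> \<le> norm (f 0) + c" using c sqrt_weight(5)[OF x] mult_left_le[of "\<bar>x\<bar>" c] by (simp add: abs_mult)
    finally show "norm (f x) \<le> norm (f 0) + c" .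
  qed (use c in simp)
qed

lemma L2_scaleR_continuous:
  assumes "w \<in> L2" "continuous_on {-1..1} \<phi>"
  shows "(\<lambda>x. \<phi> x *\<^sub>R w x) \<in> L2"
proof -
  have "bounded (\<phi> ` {-1..1})"
    using assms(2) by (intro compact_imp_bounded compact_continuous_image) auto
  then obtain M where M: "\<forall>y\<in>\<phi> ` {-1..1}. norm y \<le> M" unfolding bounded_iff ..
  show ?thesis
  proof (rule L2_scaleR[OF assms(1)])
    show "continuous_on II \<phi>" using assms(2) by (rule continuous_on_subset) (auto simp: II_def)
    show "\<bar>\<phi> x\<bar> \<le> M" if "x \<in> II" for x using M that unfolding II_def by auto
  qed
qed

text \<open>The common last step of both inclusions: l^2[f] and p^2 f'''' differ by the three given
  functions with bounded coefficients.\<close>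

lemma legendre_sq_L2_iff:
  assumes f: "f \<in> AC3_loc" and f1: "D f \<in> L2" and f2: "D (D f) \<in> L2"
    and f3: "(\<lambda>x. (1 - x\<^sup>2) *\<^sub>R D (D (D f)) x) \<in> L2"
  shows "legendre_sq f \<in> L2 \<longleftrightarrow> (\<lambda>x. (1 - x\<^sup>2)\<^sup>2 *\<^sub>R D (D (D (D f))) x) \<in> L2" (is "_ \<longleftrightarrow> ?w \<in> L2")
proof -
  define z where "z x = (- 8 * x) *\<^sub>R ((1 - x\<^sup>2) *\<^sub>R D (D (D f)) x)
      + ((12 * x\<^sup>2 - 4 - 2 * (1 - x\<^sup>2)) *\<^sub>R D (D f) x + (4 * x) *\<^sub>R D f x)" for x
  have z: "z \<in> L2"
    unfolding z_def[abs_def] by (intro L2_add L2_scaleR_continuous f1 f2 f3 continuous_intros)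
  define N where "N = {x \<in> II. \<not> D (D (D f)) differentiable (at x)}"
  have N: "negligible N" unfolding N_def by (intro AC_loc_differentiable_ae AC3_locD[OF f])
  have eq: "legendre_sq f x = ?w x + z x" if "x \<in> II - N" for x
    using legendre_sq_boundary_form(1)[OF f, of x] that unfolding N_def z_def by (simp add: scaleR_conv_of_real algebra_simps)
  show ?thesis
  proof
    assume "?w \<in> L2"
    then show "legendre_sq f \<in> L2" by (rule L2_spike[OF L2_add[OF _ z] N]) (rule eq)
  next
    assume l: "legendre_sq f \<in> L2"
    have "(\<lambda>x. (-1) *\<^sub>R z x) \<in> L2" by (intro L2_scaleR_continuous z continuous_intros)
    from L2_add[OF l this] show "?w \<in> L2" by (rule L2_spike[OF _ N]) (use eq in auto)
  qed
qed


section \<open>The inclusion of \<open>B\<close> in the domain\<close>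

lemma B_subset_dom_S: "B \<subseteq> dom_S"
proof
  fix f assume "f \<in> B"
  then have f: "f \<in> AC3_loc" and w: "(\<lambda>x. (1 - x\<^sup>2)\<^sup>2 *\<^sub>R D (D (D (D f))) x) \<in> L2"
    unfolding B_def by (simp_all add: eval_nat_numeral)
  note d = AC3_locD(1-3)[OF f] and ac = AC3_locD(4-7)[OF f]
  obtain C where C: "\<And>x. x \<in> II \<Longrightarrow> (1 - x\<^sup>2) ^ 3 * (norm (D (D (D f)) x))\<^sup>2 \<le> C"
    using AC_loc_growth[OF ac(4) w negligible_empty] by auto
  have C0: "0 \<le> C" using C[of 0] unfolding II_def by (auto intro: order_trans[OF zero_le_power2])
  define c where "c = sqrt C"
  have c: "0 \<le> c" using C0 unfolding c_def by simp
  have b3: "norm (D (D (D f)) x) \<le> c / ((1 - x\<^sup>2) * sqrt (1 - x\<^sup>2))" if x: "x \<in> II" for x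
  proof -
    define q where "q = 1 - x\<^sup>2"
    have q: "0 < q" using weight_pos[OF x] unfolding q_def .
    have "((q * sqrt q) * norm (D (D (D f)) x))\<^sup>2 = q ^ 3 * (norm (D (D (D f)) x))\<^sup>2"
      using q by (simp add: power_mult_distrib eval_nat_numeral)
    also have "\<dots> \<le> C" using C[OF x] unfolding q_def .
    finally have "(q * sqrt q) * norm (D (D (D f)) x) \<le> c" unfolding c_def by (rule real_le_rsqrt)
    then show ?thesis using q unfolding q_def[symmetric] by (simp add: field_simps)
  qed
  obtain c2 where c2: "0 \<le> c2" "\<And>x. x \<in> II \<Longrightarrow> norm (D (D f) x) \<le> c2 / sqrt (1 - x\<^sup>2)"
    using bound_of_deriv_bound(1)[OF d(3) c b3] by blast
  obtain c1 where c1: "0 \<le> c1" "\<And>x. x \<in> II \<Longrightarrow> norm (D f x) \<le> c1"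
    using bound_of_deriv_bound(2)[OF d(2) c2] by blast
  obtain c0 where c0: "0 \<le> c0" "\<And>x. x \<in> II \<Longrightarrow> norm (f x) \<le> c0"
    using bound_of_deriv_bound(3)[OF d(1) c1] by blast
  have L1: "D f \<in> L2" and L0: "f \<in> L2"
    using AC_loc_continuous_on ac(1,2) c0(2) c1(2) by (auto intro: L2_continuous_bounded)
  \<comment> \<open>Case m = 1 for v = f''': the required bound for p^3 |v|^2 is exactly the growth
    bound \<open>C\<close>.\<close>
  have L3: "(\<lambda>x. (1 - x\<^sup>2) *\<^sub>R D (D (D f)) x) \<in> L2"
    using Hardy_inequality[OF ac(4) w negligible_empty, of 1 C] C by simp
  have L2': "D (D f) \<in> L2"
  proof -
    \<comment> \<open>Case m = 0 for v = f'', fed with the function p f''' just found to be square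
      integrable.\<close>
    have "(\<lambda>t. (1 - t\<^sup>2) powi 0 *\<^sub>R D (D f) t) \<in> L2"
    proof (rule Hardy_inequality[OF ac(3) L3 negligible_empty])
      show "(1 - t\<^sup>2) powi (0 + 1) * norm (D (D (D f)) t) \<le> norm ((1 - t\<^sup>2) *\<^sub>R D (D (D f)) t)" if "t \<in> II - {}" for t
        using weight_pos[of t] that by simp
      show "(1 - t\<^sup>2) powi (2 * 0 + 1) * (norm (D (D f) t))\<^sup>2 \<le> c2\<^sup>2" if t: "t \<in> II" for t
      proof -
        have "(sqrt (1 - t\<^sup>2) * norm (D (D f) t))\<^sup>2 \<le> c2\<^sup>2"
          using c2(2)[OF t] sqrt_weight(1)[OF t] by (intro power_mono) (auto simp: field_simps)
        then show ?thesis using weight_pos[OF t] by (simp add: power_mult_distrib)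
      qed
    qed
    then show ?thesis by simp
  qed
  have legendre: "legendre_sq f \<in> L2"
    using w legendre_sq_L2_iff[OF f L1 L2' L3] by simp
  \<comment> \<open>In powers of s = sqrt p: p^2 f''' is s^4 times O(s^(-3)), p f'' is s^2 times
    O(s^(-1)), and p f' is s^2 times O(1). Each is O(s).\<close>
  have bd: "norm (boundary_form f x) \<le> (c + 4 * c2 + 2 * c1) * sqrt (1 - x\<^sup>2)"
    and p2: "norm ((1 - x\<^sup>2)\<^sup>2 *\<^sub>R D (D f) x) \<le> c2 * sqrt (1 - x\<^sup>2)" if x: "x \<in> II" for x
  proof -
    define s where "s = sqrt (1 - x\<^sup>2)"
    have s: "0 < s" "s \<le> 1" "1 - x\<^sup>2 = s * s" "\<bar>x\<bar> \<le> 1" "s * s \<le> s"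
      using sqrt_weight[OF x] unfolding s_def by auto
    have n3: "norm (D (D (D f)) x) \<le> c / (s * s * s)" using b3[OF x] unfolding s_def[symmetric] unfolding s(3) .
    have n2: "norm (D (D f) x) \<le> c2 / s" using c2(2)[OF x] unfolding s_def[symmetric] .
    have "norm ((1 - x\<^sup>2)\<^sup>2 *\<^sub>R D (D (D f)) x) = s * (s * s * s * norm (D (D (D f)) x))"
      unfolding s(3) using s(1) by (simp add: power2_eq_square)
    also have "\<dots> \<le> s * c" using n3 s(1) by (intro mult_left_mono) (auto simp: field_simps)
    finally have 3: "norm ((1 - x\<^sup>2)\<^sup>2 *\<^sub>R D (D (D f)) x) \<le> c * s" by (simp add: mult.commute)
    have sn2: "s * norm (D (D f) x) \<le> c2" using n2 s(1) by (simp add: field_simps)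
    have "norm ((4 * x * (1 - x\<^sup>2)) *\<^sub>R D (D f) x) = 4 * \<bar>x\<bar> * (s * (s * norm (D (D f) x)))"
      unfolding s(3) using s(1) by (simp add: abs_mult)
    also have "\<dots> \<le> 4 * 1 * (s * c2)" using s sn2 c2(1) by (intro mult_mono) auto
    finally have 2: "norm ((4 * x * (1 - x\<^sup>2)) *\<^sub>R D (D f) x) \<le> 4 * c2 * s" by (simp add: mult_ac)
    have "norm ((2 * (1 - x\<^sup>2)) *\<^sub>R D f x) = 2 * ((s * s) * norm (D f x))"
      unfolding s(3) using s(1) by (simp add: abs_mult)
    also have "\<dots> \<le> 2 * (s * c1)" using s c1(2)[OF x] c1(1) by (intro mult_left_mono mult_mono) auto
    finally have 1: "norm ((2 * (1 - x\<^sup>2)) *\<^sub>R D f x) \<le> 2 * c1 * s" by (simp add: mult_ac)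
    have "norm (boundary_form f x) \<le> norm ((1 - x\<^sup>2)\<^sup>2 *\<^sub>R D (D (D f)) x) + norm ((4 * x * (1 - x\<^sup>2)) *\<^sub>R D (D f) x)
        + norm ((2 * (1 - x\<^sup>2)) *\<^sub>R D f x)"
      unfolding boundary_form_def by (intro order_trans[OF norm_triangle_ineq4] add_right_mono norm_triangle_ineq4)
    with 1 2 3 show "norm (boundary_form f x) \<le> (c + 4 * c2 + 2 * c1) * sqrt (1 - x\<^sup>2)"
      unfolding s_def[symmetric] by (simp add: algebra_simps)
    have "norm ((1 - x\<^sup>2)\<^sup>2 *\<^sub>R D (D f) x) = (s * s) * (s * (s * norm (D (D f) x)))"
      unfolding s(3) using s(1) by (simp add: power2_eq_square)
    also have "\<dots> \<le> 1 * (s * c2)"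
      by (intro mult_mono mult_left_mono order_trans[OF s(5,2)] sn2) (use s(1) in auto)
    finally show "norm ((1 - x\<^sup>2)\<^sup>2 *\<^sub>R D (D f) x) \<le> c2 * sqrt (1 - x\<^sup>2)"
      unfolding s_def[symmetric] by (simp add: mult.commute)
  qed
  have id: "norm (sesq_form f complex_of_real x) \<le> (c + 5 * c2 + 2 * c1 + 2 * c0) * sqrt (1 - x\<^sup>2)" if x: "x \<in> II" for x
  proof -
    note s = sqrt_weight[OF x]
    have "norm (x *\<^sub>R boundary_form f x) \<le> 1 * norm (boundary_form f x)" using s(5) by (simp add: mult_left_le_one_le)
    moreover have "norm ((2 * (1 - x\<^sup>2)) *\<^sub>R f x) = 2 * ((1 - x\<^sup>2) * norm (f x))"
      using weight_pos[OF x] by (simp add: abs_mult)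
    moreover have "(1 - x\<^sup>2) * norm (f x) \<le> sqrt (1 - x\<^sup>2) * c0"
      using s(1,4) c0(2)[OF x] by (intro mult_mono) auto
    moreover have "norm (sesq_form f complex_of_real x) \<le> norm (x *\<^sub>R boundary_form f x) + norm ((1 - x\<^sup>2)\<^sup>2 *\<^sub>R D (D f) x)
        + norm ((2 * (1 - x\<^sup>2)) *\<^sub>R f x)"
      unfolding sesq_form_ident sesq_form_one_boundary_form[OF f x]
      by (intro order_trans[OF norm_triangle_ineq] add_right_mono norm_triangle_ineq4)
    ultimately show ?thesis using bd[OF x] p2[OF x] by (simp add: algebra_simps)
  qed
  have one: "norm (sesq_form f (\<lambda>_. 1) x) \<le> (c + 4 * c2 + 2 * c1) * sqrt (1 - x\<^sup>2)" if "x \<in> II" for x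
    using bd[OF that] sesq_form_one_boundary_form[OF f that] by simp
  show "f \<in> dom_S"
    unfolding dom_S_def
    using f L0 legendre tendsto_0_of_sqrt_weight[OF one] tendsto_0_of_sqrt_weight[OF id] by simp
qed

section \<open>The converse inclusion\<close>

lemma dom_S_subset_B: "dom_S \<subseteq> B"
proof
  fix f assume "f \<in> dom_S"
  then have f: "f \<in> AC3_loc" and F: "legendre_sq f \<in> L2"
    and lim1: "(sesq_form f (\<lambda>_. 1) \<longlongrightarrow> 0) (at_left 1)" "(sesq_form f (\<lambda>_. 1) \<longlongrightarrow> 0) (at_right (-1))"
    and limx: "(sesq_form f complex_of_real \<longlongrightarrow> 0) (at_left 1)" "(sesq_form f complex_of_real \<longlongrightarrow> 0) (at_right (-1))"
    unfolding dom_S_def by auto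
  note d = AC3_locD(1-3)[OF f] and ac = AC3_locD(4-7)[OF f]
  have ends: "\<forall>\<^sub>F x in at_left 1. x \<in> II" "\<forall>\<^sub>F x in at_right (-1). x \<in> II"
    using eventually_at_left_real[of "-1" 1] eventually_at_right_real[of "-1" 1] unfolding II_def by simp_all
  have \<Phi>: "boundary_form f \<in> AC_loc" by (rule boundary_form_AC_loc[OF f])
  have lim\<Phi>: "(boundary_form f \<longlongrightarrow> 0) (at_left 1)" "(boundary_form f \<longlongrightarrow> 0) (at_right (-1))"
    using lim1 ends sesq_form_one_boundary_form[OF f]
    by (auto elim!: Lim_transform_eventually elim: eventually_mono)
  define N where "N = {x \<in> II. \<not> D (D (D f)) differentiable (at x)}"
  have N: "negligible N" unfolding N_def by (rule AC_loc_differentiable_ae[OF ac(4)])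
  have D\<Phi>: "D (boundary_form f) x = legendre_sq f x" if "x \<in> II - N" for x
    using legendre_sq_boundary_form(2)[OF f, of x] that unfolding N_def by simp
  \<comment> \<open>The exponent j = 0 gives |[f,1]|^2 = O(p), the boundary bound that Hardy's
    inequality with m = -1 asks for.\<close>
  obtain C where C: "\<And>x. x \<in> II \<Longrightarrow> (norm (boundary_form f x))\<^sup>2 \<le> C * (1 - x\<^sup>2)"
    using AC_loc_decay[OF \<Phi> F N lim\<Phi>, of 0] D\<Phi> by auto
  have C0: "0 \<le> C" using order_trans[OF zero_le_power2 C[of 0]] unfolding II_def by simp
  define c where "c = sqrt C"
  have c: "0 \<le> c" using C0 unfolding c_def by simp
  \<comment> \<open>\<open>q\<close> is (p f')' written out and \<open>q'\<close> its derivative, so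
    that [f,1] = p q'.\<close>
  define q where "q x = (1 - x\<^sup>2) *\<^sub>R D (D f) x - (2 * x) *\<^sub>R D f x" for x
  define q' where "q' x = (1 - x\<^sup>2) *\<^sub>R D (D (D f)) x - (4 * x) *\<^sub>R D (D f) x - 2 *\<^sub>R D f x" for x
  have q: "(q has_vector_derivative q' x) (at x)" if x: "x \<in> II" for x
    unfolding q_def[abs_def] q'_def
    by (rule derivative_eq_intros d(2)[OF x] d(3)[OF x] refl)+ (simp add: scaleR_conv_of_real algebra_simps)
  have \<Phi>q: "boundary_form f x = (1 - x\<^sup>2) *\<^sub>R q' x" for x
    unfolding boundary_form_def q'_def by (simp add: scaleR_conv_of_real power2_eq_square algebra_simps)
  have q'L2: "q' \<in> L2"
  proof -
    have "(\<lambda>t. (1 - t\<^sup>2) powi (-1) *\<^sub>R boundary_form f t) \<in> L2"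
    proof (rule Hardy_inequality[OF \<Phi> F N])
      show "(1 - t\<^sup>2) powi (-1 + 1) * norm (D (boundary_form f) t) \<le> norm (legendre_sq f t)" if "t \<in> II - N" for t
        using D\<Phi>[OF that] by simp
      show "(1 - t\<^sup>2) powi (2 * (-1) + 1) * (norm (boundary_form f t))\<^sup>2 \<le> C" if t: "t \<in> II" for t
        using C[OF t] weight_pos[OF t] by (simp add: power_int_minus field_simps)
    qed
    then show ?thesis
      by (rule L2_spike[OF _ negligible_empty]) (use weight_pos in \<open>force simp: \<Phi>q power_int_minus\<close>)
  qed
  have q'b: "norm (q' x) \<le> c / sqrt (1 - x\<^sup>2)" if x: "x \<in> II" for x
  proof -
    define p where "p = 1 - x\<^sup>2"
    have p: "0 < p" using weight_pos[OF x] unfolding p_def .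
    have "p * (p * (norm (q' x))\<^sup>2) \<le> p * C"
      using C[OF x] p unfolding \<Phi>q p_def[symmetric] by (simp add: power_mult_distrib power2_eq_square mult_ac)
    then have "(sqrt p * norm (q' x))\<^sup>2 \<le> C" using p by (simp add: power_mult_distrib)
    then have "sqrt p * norm (q' x) \<le> c" unfolding c_def by (rule real_le_rsqrt)
    then show ?thesis using p unfolding p_def[symmetric] by (simp add: field_simps)
  qed
  obtain M where M: "0 \<le> M" "\<And>x. x \<in> II \<Longrightarrow> norm (q x) \<le> M"
    using bound_of_deriv_bound(2)[OF q c q'b] by blast
  define g where "g x = (1 - x\<^sup>2) *\<^sub>R D f x" for x
  have g: "(g has_vector_derivative q x) (at x)" if x: "x \<in> II" for x
    unfolding g_def[abs_def] q_def
    by (rule derivative_eq_intros d(2)[OF x] refl)+ (simp add: algebra_simps)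
  obtain M1 where M1: "0 \<le> M1" "\<And>x. x \<in> II \<Longrightarrow> norm (g x) \<le> M1"
    using bound_of_deriv_bound(3)[OF g M] by blast
  \<comment> \<open>Boundedness of p f' gives f' = O(1/p), weakened here to the exponent -3/2, whose
    primitive is at hand. The resulting f = O(p^(-1/2)) is crude, but all that is required is that p
    f tends to 0.\<close>
  have f1: "norm (D f x) \<le> M1 / ((1 - x\<^sup>2) * sqrt (1 - x\<^sup>2))" if x: "x \<in> II" for x
  proof -
    define p s where "p = 1 - x\<^sup>2" and "s = sqrt p"
    have p: "0 < p" "0 < s" "s \<le> 1" using weight_pos[OF x] sqrt_weight[OF x] unfolding p_def s_def by auto
    have "norm (D f x) * (p * s) = (p * norm (D f x)) * s" by simp
    also have "\<dots> \<le> M1 * 1" using M1(2)[OF x] M1(1) p unfolding g_def p_def[symmetric] by (intro mult_mono) auto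
    finally show ?thesis using p unfolding p_def[symmetric] s_def[symmetric] by (simp add: pos_le_divide_eq)
  qed
  obtain M2 where M2: "0 \<le> M2" "\<And>x. x \<in> II \<Longrightarrow> norm (f x) \<le> M2 / sqrt (1 - x\<^sup>2)"
    using bound_of_deriv_bound(1)[OF d(1) M1(1) f1] by blast
  \<comment> \<open>Substituting p^2 f'' = p q + 2 x p f' in [f,x] leaves p f' and known small
    terms; \<open>r\<close> collects the latter, and x [f,1] - [f,x] + r = 2 x p f'.\<close>
  define r where "r x = (2 * (1 - x\<^sup>2)) *\<^sub>R f x - (1 - x\<^sup>2) *\<^sub>R q x" for x
  have r: "norm (r x) \<le> (2 * M2 + M) * sqrt (1 - x\<^sup>2)" if x: "x \<in> II" for x
  proof -
    define s where "s = sqrt (1 - x\<^sup>2)"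
    have s: "0 < s" "s \<le> 1" "1 - x\<^sup>2 = s * s" "\<bar>x\<bar> \<le> 1" "s * s \<le> s"
      using sqrt_weight[OF x] unfolding s_def by auto
    have "s * norm (f x) \<le> M2" using M2(2)[OF x] s(1) unfolding s_def[symmetric] by (simp add: field_simps)
    then have 1: "norm ((2 * (1 - x\<^sup>2)) *\<^sub>R f x) \<le> 2 * (s * M2)"
      unfolding s(3) using s(1) by (simp add: abs_mult)
    have 2: "norm ((1 - x\<^sup>2) *\<^sub>R q x) \<le> s * M"
    proof -
      have "norm ((s * s) *\<^sub>R q x) = (s * s) * norm (q x)" by simp
      also have "\<dots> \<le> s * M" using s M(2)[OF x] by (intro mult_mono) auto
      finally show ?thesis unfolding s(3) .
    qed
    have "norm (r x) \<le> norm ((2 * (1 - x\<^sup>2)) *\<^sub>R f x) + norm ((1 - x\<^sup>2) *\<^sub>R q x)"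
      unfolding r_def by (rule norm_triangle_ineq4)
    with 1 2 show ?thesis unfolding s_def[symmetric] by (simp add: algebra_simps)
  qed
  have "x *\<^sub>R sesq_form f (\<lambda>_. 1) x - sesq_form f complex_of_real x + r x = (2 * x) *\<^sub>R g x" for x
    unfolding sesq_form_ident r_def q_def g_def by (simp add: scaleR_conv_of_real power2_eq_square algebra_simps)
  then have geq: "g x = (1 / (2 * x)) *\<^sub>R (x *\<^sub>R sesq_form f (\<lambda>_. 1) x - sesq_form f complex_of_real x + r x)" if "x \<noteq> 0" for x
    using that by simp
  \<comment> \<open>Stated for a general base point so that both ends are covered;
    \<open>y \<noteq> 0\<close> allows the division by \<open>2 * x\<close>.\<close>
  have limg: "(g \<longlongrightarrow> 0) Fl"
    if "Fl = at y within S" "y \<noteq> 0" "(sesq_form f (\<lambda>_. 1) \<longlongrightarrow> 0) Fl" "(sesq_form f complex_of_real \<longlongrightarrow> 0) Fl" "(r \<longlongrightarrow> 0) Fl" for Fl y S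
  proof -
    have id: "((\<lambda>x. x) \<longlongrightarrow> y) Fl" unfolding that(1) by (rule tendsto_ident_at)
    have "((\<lambda>x. (1 / (2 * x)) *\<^sub>R (x *\<^sub>R sesq_form f (\<lambda>_. 1) x - sesq_form f complex_of_real x + r x)) \<longlongrightarrow>
       (1 / (2 * y)) *\<^sub>R (y *\<^sub>R 0 - 0 + 0)) Fl"
      using that(2) by (intro tendsto_intros id that(3-5)) auto
    then have "((\<lambda>x. (1 / (2 * x)) *\<^sub>R (x *\<^sub>R sesq_form f (\<lambda>_. 1) x - sesq_form f complex_of_real x + r x)) \<longlongrightarrow> 0) Fl"
      by simp
    moreover have "\<forall>\<^sub>F x in Fl. (1 / (2 * x)) *\<^sub>R (x *\<^sub>R sesq_form f (\<lambda>_. 1) x - sesq_form f complex_of_real x + r x) = g x"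
      using tendsto_imp_eventually_ne[OF id that(2)] by eventually_elim (rule geq[symmetric])
    ultimately show ?thesis by (rule Lim_transform_eventually)
  qed
  have limg': "(g \<longlongrightarrow> 0) (at_left 1)" "(g \<longlongrightarrow> 0) (at_right (-1))"
    using limg[OF refl _ lim1(1) limx(1)] limg[OF refl _ lim1(2) limx(2)] tendsto_0_of_sqrt_weight[OF r] by auto
  \<comment> \<open>Now p f' vanishes at the ends and its derivative \<open>q\<close> is bounded by
    \<open>M\<close>, so it is at most \<open>M\<close> times p. Cancelling p bounds f'.\<close>
  have gb: "norm (g x) \<le> M * (1 - x\<^sup>2)" if "x \<in> II" for x
    by (rule C1_decay[OF g M(2) limg' that])
  have f1b: "norm (D f x) \<le> M" if "x \<in> II" for x
    using gb[OF that] weight_pos[OF that] unfolding g_def by simp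
  have L1: "D f \<in> L2" using AC_loc_continuous_on[OF ac(2)] f1b by (rule L2_continuous_bounded)
  define W where "W x = (1 - x\<^sup>2)\<^sup>2 *\<^sub>R D (D f) x" for x
  define k where "k x = q' x + 2 *\<^sub>R D f x" for x
  have k: "k \<in> L2" unfolding k_def[abs_def] by (intro L2_add q'L2 L2_scaleR_continuous L1 continuous_intros)
  have W: "W \<in> AC_loc" unfolding W_def[abs_def]
    by (rule AC_loc_scaleR[OF _ _ ac(3), where \<phi>'="\<lambda>x. - 4 * x * (1 - x\<^sup>2)"])
      (auto intro!: derivative_eq_intros continuous_intros)
  have DW: "D W x = (1 - x\<^sup>2) *\<^sub>R k x" if "x \<in> II" for x
    unfolding W_def[abs_def] D_eq[OF D_leading[OF f that]] k_def q'_def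
    by (simp add: scaleR_conv_of_real power2_eq_square algebra_simps)
  \<comment> \<open>A preliminary bound, whose only purpose is that \<open>W\<close> tends to 0 at
    both ends.\<close>
  have Wb: "norm (W x) \<le> (3 * M) * sqrt (1 - x\<^sup>2)" if x: "x \<in> II" for x
  proof -
    note s = sqrt_weight[OF x]
    have "W x = (1 - x\<^sup>2) *\<^sub>R q x + (2 * x) *\<^sub>R g x"
      unfolding W_def q_def g_def by (simp add: scaleR_conv_of_real power2_eq_square algebra_simps)
    then have "norm (W x) \<le> norm ((1 - x\<^sup>2) *\<^sub>R q x) + norm ((2 * x) *\<^sub>R g x)"
      using norm_triangle_ineq[of "(1 - x\<^sup>2) *\<^sub>R q x" "(2 * x) *\<^sub>R g x"] by simp
    moreover have "norm ((1 - x\<^sup>2) *\<^sub>R q x) \<le> (1 - x\<^sup>2) * M"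
      using weight_pos[OF x] M(2)[OF x] by simp
    moreover have "norm ((2 * x) *\<^sub>R g x) \<le> 2 * (M * (1 - x\<^sup>2))"
    proof -
      have "norm ((2 * x) *\<^sub>R g x) = 2 * (\<bar>x\<bar> * norm (g x))" by (simp add: abs_mult)
      also have "\<dots> \<le> 2 * (1 * (M * (1 - x\<^sup>2)))" using s(5) gb[OF x] by (intro mult_left_mono mult_mono) auto
      finally show ?thesis by simp
    qed
    ultimately have "norm (W x) \<le> 3 * M * (1 - x\<^sup>2)" by (simp add: algebra_simps)
    also have "\<dots> \<le> 3 * M * sqrt (1 - x\<^sup>2)" using s(4) M(1) by (intro mult_left_mono) auto
    finally show ?thesis .
  qed
  have DWk: "norm (D W t) = (1 - t\<^sup>2) * norm (k t)" if "t \<in> II" for t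
    using weight_pos[OF that] by (simp add: DW[OF that])
  \<comment> \<open>With W vanishing at the ends and |W'| = p |k|, the exponent j = 1 improves the
    bound to |W|^2 = O(p^3), the boundary bound for m = -2.\<close>
  obtain C' where C': "\<And>x. x \<in> II \<Longrightarrow> (norm (W x))\<^sup>2 \<le> C' * (1 - x\<^sup>2) ^ 3"
  proof (rule AC_loc_decay[OF W k negligible_empty tendsto_0_of_sqrt_weight[OF Wb], of 1])
    show "norm (D W t) \<le> (1 - t\<^sup>2) ^ 1 * norm (k t)" if "t \<in> II - {}" for t
      using that by (simp add: DWk)
    fix C assume C: "\<And>x. x \<in> II \<Longrightarrow> (norm (W x))\<^sup>2 \<le> C * (1 - x\<^sup>2) ^ (2 * 1 + 1)"
    show thesis by (rule that[of C]) (use C in simp)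
  qed
  have L2': "D (D f) \<in> L2"
  proof -
    \<comment> \<open>Case m = -2: the weight p^(-2) turns \<open>W\<close> back into f'', and
      p^(-1) |W'| is |k|.\<close>
    have "(\<lambda>t. (1 - t\<^sup>2) powi (-2) *\<^sub>R W t) \<in> L2"
    proof (rule Hardy_inequality[OF W k negligible_empty])
      show "(1 - t\<^sup>2) powi (-2 + 1) * norm (D W t) \<le> norm (k t)" if t: "t \<in> II - {}" for t
      proof -
        have "t \<in> II" using t by simp
        then show ?thesis using weight_pos[of t] by (simp add: DWk power_int_minus field_simps)
      qed
      show "(1 - t\<^sup>2) powi (2 * (-2) + 1) * (norm (W t))\<^sup>2 \<le> C'" if t: "t \<in> II" for t
        using C'[OF t] weight_pos[OF t] by (simp add: power_int_minus field_simps)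
    qed
    then show ?thesis
      by (rule L2_spike[OF _ negligible_empty]) (use weight_pos in \<open>force simp: W_def power_int_minus\<close>)
  qed
  have L3: "(\<lambda>x. (1 - x\<^sup>2) *\<^sub>R D (D (D f)) x) \<in> L2"
  proof -
    \<comment> \<open>By the definition of \<open>k\<close>, the terms in f' cancel and k = p f''' -
      4 x f''.\<close>
    have "(\<lambda>x. k x + (4 * x) *\<^sub>R D (D f) x) \<in> L2"
      by (intro L2_add k L2_scaleR_continuous L2' continuous_intros)
    then show ?thesis unfolding k_def q'_def by simp
  qed
  show "f \<in> B"
    unfolding B_def using f F legendre_sq_L2_iff[OF f L1 L2' L3] by (simp add: eval_nat_numeral)
qed

theorem theorem4:
  shows "B = dom_S"
  using B_subset_dom_S dom_S_subset_B by (rule subset_antisym)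

end
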